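(* Let $d\ge2$ and let $G$ be a $d$-regular graph of girth $g$ that is girth-maximal. Then $G$ is a Moore graph, that is, its number of vertices equals the Moore bound for degree $d$ and girth $g$.
   Context: Graphs are finite, simple and connected. The algebraic connectivity $AC(G)$ is the second smallest eigenvalue (with multiplicity) of the Laplacian matrix of $G$. A $d$-regular graph $G$ of girth $g$ is called girth-maximal if $AC(G)=d-2\sqrt{d-1}\cos\theta$, where: if $g=2K$ is even, $\theta=\pi/K$; if $g=2K+1$ is odd, $\theta$ is the smallest positive root of $$\tan(\theta K)=-\frac{\sin\theta}{(d-1)^{-1/2}+\cos\theta}.$$ (In both cases $d-2\sqrt{d-1}\cos\theta$ is an upper bound for the algebraic connectivity of every $d$-regular graph of girth $g$.) The Moore bound for degree $d$ and girth $g$ is the lower bound on the number of vertices of a $d$-regular graph of girth $g$: it is $1+d\sum_{j=0}^{K-1}(d-1)^j$ if $g=2K+1$, and $2\sum_{j=0}^{K-1}(d-1)^j$ if $g=2K$. A Moore graph is a $d$-regular graph of girth $g$ whose number of vertices equals this bound. *)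

theory Defs
  imports
    "Graph_Theory.Graph_Theory"
    "Jordan_Normal_Form.Char_Poly"
begin

text \<open>
  A finite simple graph is a symmetric digraph without loops and parallel arcs (\<^locale>\<open>graph\<close>):
  every undirected edge is a pair of opposite arcs, so the degree of a vertex is its out-degree.
\<close>

definition regular_graph :: "('a, 'b) pre_digraph \<Rightarrow> nat \<Rightarrow> bool" where
  "regular_graph G d \<longleftrightarrow> (\<forall>v \<in> verts G. out_degree G v = d)"

text \<open>
  In a symmetric digraph \<^const>\<open>pre_digraph.cycle\<close> also holds of the closed walks
  \<open>u, v, u\<close> along a single edge; the condition \<open>3 \<le> length p\<close> removes exactly these.
  The girth of a forest is \<open>\<infinity>\<close>.
\<close>

definition girth :: "('a, 'b) pre_digraph \<Rightarrow> enat" where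
  "girth G = (INF p \<in> {p. pre_digraph.cycle G p \<and> 3 \<le> length p}. enat (length p))"

text \<open>The Laplacian matrix (degree matrix minus adjacency matrix), with rows and columns
  ordered by the list \<open>vs\<close> of all vertices.\<close>

definition laplacian_matrix :: "('a, 'b) pre_digraph \<Rightarrow> 'a list \<Rightarrow> real mat" where
  "laplacian_matrix G vs = Matrix.mat (length vs) (length vs)
     (\<lambda>(i, j). (if i = j then real (out_degree G (vs ! i)) else 0)
             - (if (vs ! i, vs ! j) \<in> arcs_ends G then 1 else 0))"

definition vertex_list :: "('a, 'b) pre_digraph \<Rightarrow> 'a list" where
  "vertex_list G = (SOME vs. distinct vs \<and> set vs = verts G)"

text \<open>
  The eigenvalues of the Laplacian matrix, each repeated according to its multiplicity. The matrix
  is real symmetric, so all roots of its characteristic polynomial are real and their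
  multiplicities are the dimensions of the eigenspaces. The choice of \<^const>\<open>vertex_list\<close>
  is immaterial by \<open>char_poly_laplacian_matrix_cong\<close> below.
\<close>

definition laplacian_spectrum :: "('a, 'b) pre_digraph \<Rightarrow> real multiset" where
  "laplacian_spectrum G = proots (char_poly (laplacian_matrix G (vertex_list G)))"

definition algebraic_connectivity :: "('a, 'b) pre_digraph \<Rightarrow> real" where
  "algebraic_connectivity G = sorted_list_of_multiset (laplacian_spectrum G) ! 1"

text \<open>
  The equation \<open>tan (\<theta> K) = - sin \<theta> / ((d - 1) powr (- 1 / 2) + cos \<theta>)\<close>. Since \<open>tan\<close> and
  division are total functions here, a root is required to be a point where both sides are defined.
\<close>

definition odd_girth_root :: "nat \<Rightarrow> nat \<Rightarrow> real \<Rightarrow> bool" where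
  "odd_girth_root d K \<theta> \<longleftrightarrow>
     cos (\<theta> * real K) \<noteq> 0 \<and>
     (real d - 1) powr (- 1 / 2) + cos \<theta> \<noteq> 0 \<and>
     tan (\<theta> * real K) = - (sin \<theta> / ((real d - 1) powr (- 1 / 2) + cos \<theta>))"

definition girth_angle :: "nat \<Rightarrow> nat \<Rightarrow> real \<Rightarrow> bool" where
  "girth_angle d g \<theta> \<longleftrightarrow>
     (if even g then \<theta> = pi / real (g div 2)
      else 0 < \<theta> \<and> odd_girth_root d (g div 2) \<theta> \<and>
           (\<forall>\<phi>. 0 < \<phi> \<and> odd_girth_root d (g div 2) \<phi> \<longrightarrow> \<theta> \<le> \<phi>))"

definition girth_maximal :: "('a, 'b) pre_digraph \<Rightarrow> nat \<Rightarrow> nat \<Rightarrow> bool" where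
  "girth_maximal G d g \<longleftrightarrow> regular_graph G d \<and> girth G = enat g \<and>
     (\<exists>\<theta>. girth_angle d g \<theta> \<and>
          algebraic_connectivity G = real d - 2 * sqrt (real d - 1) * cos \<theta>)"

definition moore_bound :: "nat \<Rightarrow> nat \<Rightarrow> nat" where
  "moore_bound d g =
     (if even g then 2 * (\<Sum>j<g div 2. (d - 1) ^ j)
      else 1 + d * (\<Sum>j<g div 2. (d - 1) ^ j))"

definition moore_graph :: "('a, 'b) pre_digraph \<Rightarrow> nat \<Rightarrow> nat \<Rightarrow> bool" where
  "moore_graph G d g \<longleftrightarrow>
     regular_graph G d \<and> girth G = enat g \<and> card (verts G) = moore_bound d g"

lemma vertex_list:
  assumes "finite (verts G)"
  shows "distinct (vertex_list G)" "set (vertex_list G) = verts G"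
proof -
  have "\<exists>vs. distinct vs \<and> set vs = verts G"
    using finite_distinct_list[OF assms] by blast
  from someI_ex[OF this] have "distinct (vertex_list G) \<and> set (vertex_list G) = verts G"
    unfolding vertex_list_def .
  then show "distinct (vertex_list G)" "set (vertex_list G) = verts G" by simp_all
qed

lemma char_poly_laplacian_matrix_cong:
  assumes "distinct xs" "distinct ys" "set xs = set ys"
  shows "char_poly (laplacian_matrix G xs) = char_poly (laplacian_matrix G ys)"
proof (rule char_poly_similar)
  define n where "n = length xs"
  have n: "length xs = n" "length ys = n"
    using distinct_card[OF assms(1)] distinct_card[OF assms(2)] assms(3) by (simp_all add: n_def)
  define P where "P = Matrix.mat n n (\<lambda>(i, j). if xs ! i = ys ! j then 1 else (0::real))"
  define Q where "Q = Matrix.mat n n (\<lambda>(i, j). if ys ! i = xs ! j then 1 else (0::real))"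
  have ex: "\<exists>f. \<forall>i<n. f i < n \<and> us ! f i = vs ! i"
    if "set us = set vs" "length us = n" "length vs = n" for us vs :: "'a list"
  proof -
    have "\<forall>i. \<exists>k. i < n \<longrightarrow> k < n \<and> us ! k = vs ! i"
    proof (intro allI)
      fix i
      show "\<exists>k. i < n \<longrightarrow> k < n \<and> us ! k = vs ! i"
        using that nth_mem[of i vs] in_set_conv_nth[of "vs ! i" us] by auto
    qed
    then show ?thesis by (rule choice)
  qed
  obtain f where f: "\<And>i. i < n \<Longrightarrow> f i < n \<and> ys ! f i = xs ! i"
    using ex[of ys xs] assms n by auto
  obtain h where h: "\<And>i. i < n \<Longrightarrow> h i < n \<and> xs ! h i = ys ! i"
    using ex[of xs ys] assms n by auto
  have fy: "xs ! i = ys ! j \<longleftrightarrow> j = f i" if "i < n" "j < n" for i j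
    using f[OF that(1)] that assms(2) n nth_eq_iff_index_eq[of ys "f i" j] by auto
  have hx: "ys ! i = xs ! j \<longleftrightarrow> j = h i" if "i < n" "j < n" for i j
    using h[OF that(1)] that assms(1) n nth_eq_iff_index_eq[of xs "h i" j] by auto
  have hf: "h (f i) = i" "f (h i) = i" if "i < n" for i
  proof -
    show "h (f i) = i"
      using iffD1[OF hx[OF conjunct1[OF f[OF that]] that] conjunct2[OF f[OF that]]] by (rule sym)
    show "f (h i) = i"
      using iffD1[OF fy[OF conjunct1[OF h[OF that]] that] conjunct2[OF h[OF that]]] by (rule sym)
  qed
  let ?A = "laplacian_matrix G xs" and ?B = "laplacian_matrix G ys"
  show "similar_mat ?A ?B"
    unfolding similar_mat_def similar_mat_wit_def Let_def
  proof (intro exI conjI)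
    have dim: "?A \<in> carrier_mat n n" "?B \<in> carrier_mat n n" "P \<in> carrier_mat n n" "Q \<in> carrier_mat n n"
      using n by (auto simp: laplacian_matrix_def P_def Q_def)
    show "{?A, ?B, P, Q} \<subseteq> carrier_mat (dim_row ?A) (dim_row ?A)"
      using dim by auto
    have mult: "(M * N) $$ (i, j) = (\<Sum>k<n. M $$ (i, k) * N $$ (k, j))"
      if "M \<in> carrier_mat n n" "N \<in> carrier_mat n n" "i < n" "j < n"
      for M N :: "real mat" and i j
      using that by (simp add: scalar_prod_def atLeast0LessThan)
    have P1: "(P * M) $$ (i, j) = M $$ (f i, j)"
      if "M \<in> carrier_mat n n" "i < n" "j < n" for M i j
    proof -
      have "(P * M) $$ (i, j) = (\<Sum>k<n. P $$ (i, k) * M $$ (k, j))"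
        by (rule mult[OF dim(3) that])
      also have "\<dots> = (\<Sum>k<n. if k = f i then M $$ (k, j) else 0)"
        by (rule sum.cong) (simp_all add: P_def fy that)
      also have "\<dots> = M $$ (f i, j)"
        using f[OF that(2)] by simp
      finally show ?thesis .
    qed
    have Q1: "(Q * M) $$ (i, j) = M $$ (h i, j)"
      if "M \<in> carrier_mat n n" "i < n" "j < n" for M i j
    proof -
      have "(Q * M) $$ (i, j) = (\<Sum>k<n. Q $$ (i, k) * M $$ (k, j))"
        by (rule mult[OF dim(4) that])
      also have "\<dots> = (\<Sum>k<n. if k = h i then M $$ (k, j) else 0)"
        by (rule sum.cong) (simp_all add: Q_def hx that)
      also have "\<dots> = M $$ (h i, j)"
        using h[OF that(2)] by simp
      finally show ?thesis .
    qed
    have PQ: "P * Q = 1\<^sub>m n"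
    proof (rule eq_matI)
      fix i j assume "i < dim_row (1\<^sub>m n :: real mat)" "j < dim_col (1\<^sub>m n :: real mat)"
      then have ij: "i < n" "j < n" by simp_all
      have "(P * Q) $$ (i, j) = Q $$ (f i, j)" by (rule P1[OF dim(4) ij])
      also have "\<dots> = (if j = i then 1 else 0)"
        using conjunct1[OF f[OF ij(1)]] by (simp add: Q_def hx hf ij)
      finally show "(P * Q) $$ (i, j) = 1\<^sub>m n $$ (i, j)"
        using ij by simp
    qed (use dim in auto)
    have QP: "Q * P = 1\<^sub>m n"
    proof (rule eq_matI)
      fix i j assume "i < dim_row (1\<^sub>m n :: real mat)" "j < dim_col (1\<^sub>m n :: real mat)"
      then have ij: "i < n" "j < n" by simp_all
      have "(Q * P) $$ (i, j) = P $$ (h i, j)" by (rule Q1[OF dim(3) ij])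
      also have "\<dots> = (if j = i then 1 else 0)"
        using conjunct1[OF h[OF ij(1)]] by (simp add: P_def fy hf ij)
      finally show "(Q * P) $$ (i, j) = 1\<^sub>m n $$ (i, j)"
        using ij by simp
    qed (use dim in auto)
    show "P * Q = 1\<^sub>m (dim_row ?A)" "Q * P = 1\<^sub>m (dim_row ?A)"
      using PQ QP dim by auto
    have "?A * P = P * ?B"
    proof (rule eq_matI)
      fix i j assume "i < dim_row (P * ?B)" "j < dim_col (P * ?B)"
      then have ij: "i < n" "j < n" using dim by auto
      have "(?A * P) $$ (i, j) = (\<Sum>k<n. ?A $$ (i, k) * P $$ (k, j))"
        by (rule mult[OF dim(1,3) ij])
      also have "\<dots> = (\<Sum>k<n. if k = h j then ?A $$ (i, k) else 0)"
      proof (rule sum.cong)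
        fix k assume "k \<in> {..<n}"
        then have k: "k < n" by simp
        have "P $$ (k, j) = (if k = h j then 1 else 0)"
          using hx[OF ij(2) k] k ij(2) by (simp add: P_def eq_commute)
        then show "?A $$ (i, k) * P $$ (k, j) = (if k = h j then ?A $$ (i, k) else 0)"
          by simp
      qed simp
      also have "\<dots> = ?A $$ (i, h j)" using h[OF ij(2)] by simp
      also have "\<dots> = ?B $$ (f i, j)"
      proof -
        have "i = h j \<longleftrightarrow> f i = j" using hf(1)[OF ij(1)] hf(2)[OF ij(2)] by auto
        then show ?thesis
          using ij f[OF ij(1)] h[OF ij(2)] by (auto simp add: laplacian_matrix_def n)
      qed
      finally show "(?A * P) $$ (i, j) = (P * ?B) $$ (i, j)"
        using P1[OF dim(2) ij] by simp
    qed (use dim in auto)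
    then have "P * ?B * Q = ?A * P * Q" by simp
    also have "\<dots> = ?A * (P * Q)" by (rule assoc_mult_mat[OF dim(1,3,4)])
    also have "\<dots> = ?A" unfolding PQ by (rule right_mult_one_mat[OF dim(1)])
    finally show "?A = P * ?B * Q" by simp
  qed
qed

end

theory Submission
  imports Defs "Jordan_Normal_Form.Schur_Decomposition"
begin

text \<open>
  The proof plays the trace of a polynomial in the adjacency matrix against its values at the
  eigenvalues, in the manner of linear programming bounds. Let \<open>q = d - 1\<close>, let \<open>n\<close> be the number
  of vertices, and let \<open>d = x\<^sub>1 \<ge> x\<^sub>2 \<ge> \<dots>\<close> be the adjacency eigenvalues. Girth-maximality
  says \<open>x\<^sub>2 = \<tau> := 2 * sqrt q * cos \<theta>\<close>, and all \<open>x\<^sub>i\<close> are at least \<open>- d\<close>.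

  For the polynomial \<open>F\<^sub>k\<close> (\<open>nb_poly\<close>), the matrix \<open>F\<^sub>k(A)\<close> counts non-backtracking walks of
  length \<open>k\<close>, and a closed one of length \<open>k \<ge> 1\<close> contains a cycle of length at most \<open>k\<close>. So the
  functional \<open>T f = tr f(A) = (\<Sum>i. f x\<^sub>i)\<close> kills \<open>F\<^sub>k\<close> for \<open>1 \<le> k < g\<close>
  (\<open>nb_count_closed_zero\<close>), while \<open>T 1 = n\<close>. With the three-term recursion it follows that
  \<open>T (F\<^sub>i * s) = 0\<close> if \<open>degree s < i\<close> and \<open>degree s + i < g\<close> (\<open>spectral_sum_orthogonal\<close>).

  For a weight \<open>w\<close> and a polynomial \<open>p\<close> of degree \<open>m\<close> chosen according to the parity of \<open>g\<close>,
  the product \<open>(x - d) * w * p\<close> is a combination of two polynomials \<open>F\<^sub>i\<close> of high index. Hence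
  \<open>T (w * p * s) = c * s(d)\<close> for all \<open>s\<close> of degree at most \<open>m\<close>, where \<open>c = T (w * p)\<close>.
  Taking \<open>s = p\<close> and keeping only the eigenvalue \<open>d\<close> gives \<open>c \<ge> w(d) * p(d)\<close>. The angle \<open>\<theta>\<close> is
  designed so that \<open>p(\<tau>) = 0\<close>; taking \<open>s = p / (x - \<tau>)\<close>, all eigenvalues other than the first \<open>d\<close>
  contribute a nonpositive term \<open>w * (x - \<tau>) * s\<^sup>2\<close>, and \<open>c \<le> w(d) * p(d)\<close>. So
  \<open>c = w(d) * p(d)\<close> (\<open>reproducing_imp_count\<close>). For \<open>g = 2 * K + 1\<close> the choice is \<open>w = 1\<close> and
  \<open>p = (\<Sum>i\<le>K. F\<^sub>i)\<close>, with \<open>c = n\<close>; for \<open>g = 2 * K\<close> it is \<open>w = x + d\<close> and \<open>p\<close> the scaled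
  Chebyshev polynomial of degree \<open>K - 1\<close>, with \<open>c = d * n\<close>. In both cases the equation says that
  \<open>n\<close> is the Moore bound. The lower bound on \<open>n\<close> thus comes out of the same computation, without
  counting the vertices in a ball.

  The trace formula \<open>T f = tr f(A)\<close> is obtained by triangularizing the Laplacian, whose
  characteristic polynomial splits over the reals because the matrix is symmetric.
\<close>

section \<open>Non-backtracking and Chebyshev polynomials\<close>

text \<open>
  In a \<open>d\<close>-regular graph with adjacency matrix \<open>A\<close>, evaluation at \<open>A\<close> counts non-backtracking
  walks: the subtracted term removes the walks that start with a detour to a neighbour and back
  before a walk of length \<open>k\<close>, and there are \<open>d - 1\<close> such detours avoiding the first step of that
  walk, or \<open>d\<close> if \<open>k = 0\<close>.
\<close>

fun nb_poly :: "real \<Rightarrow> nat \<Rightarrow> real poly" where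
  "nb_poly d 0 = 1"
| "nb_poly d (Suc 0) = [:0, 1:]"
| "nb_poly d (Suc (Suc k)) =
     [:0, 1:] * nb_poly d (Suc k) - Polynomial.smult (if k = 0 then d else d - 1) (nb_poly d k)"

text \<open>
  \<open>q\<^bsup>k/2\<^esup> U\<^sub>k(x / (2 sqrt q))\<close> for the Chebyshev polynomial \<open>U\<^sub>k\<close> of the second kind. Unlike
  \<^const>\<open>nb_poly\<close>, the recursion is uniform in \<open>k\<close>, so that these have a closed form in \<open>\<theta>\<close> at
  \<open>x = 2 * sqrt q * cos \<theta>\<close>.
\<close>

fun cheb_poly :: "real \<Rightarrow> nat \<Rightarrow> real poly" where
  "cheb_poly q 0 = 1"
| "cheb_poly q (Suc 0) = [:0, 1:]"
| "cheb_poly q (Suc (Suc k)) = [:0, 1:] * cheb_poly q (Suc k) - Polynomial.smult q (cheb_poly q k)"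

lemma nb_poly_eq_cheb_diff:
  "nb_poly d (Suc (Suc k)) = cheb_poly (d - 1) (Suc (Suc k)) - cheb_poly (d - 1) k"
proof (induction k rule: less_induct)
  case (less k)
  show ?case
  proof (cases k)
    case 0
    then show ?thesis by (simp add: one_pCons)
  next
    case (Suc l)
    show ?thesis
    proof (cases l)
      case 0
      then show ?thesis using Suc by simp
    next
      case (Suc m)
      then have "nb_poly d (Suc (Suc k)) =
          [:0, 1:] * nb_poly d (Suc (Suc l)) - Polynomial.smult (d - 1) (nb_poly d (Suc (Suc m)))"
        using \<open>k = Suc l\<close> by simp
      also have "\<dots> = [:0, 1:] * (cheb_poly (d - 1) (Suc (Suc l)) - cheb_poly (d - 1) l) -
          Polynomial.smult (d - 1) (cheb_poly (d - 1) (Suc (Suc m)) - cheb_poly (d - 1) m)"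
        using less.IH[of l] less.IH[of m] Suc \<open>k = Suc l\<close> by (simp only: lessI less_SucI)
      also have "\<dots> = cheb_poly (d - 1) (Suc (Suc k)) - cheb_poly (d - 1) k"
        unfolding \<open>k = Suc l\<close> Suc
        by (simp only: cheb_poly.simps right_diff_distrib smult_diff_right)
      finally show ?thesis .
    qed
  qed
qed

lemma sum_nb_poly: "(\<Sum>i\<le>Suc k. nb_poly d i) = cheb_poly (d - 1) (Suc k) + cheb_poly (d - 1) k"
  by (induction k) (simp_all del: nb_poly.simps(3) cheb_poly.simps(3) add: nb_poly_eq_cheb_diff)

text \<open>
  The sum of the first \<^const>\<open>nb_poly\<close>s is the odd-girth choice of \<open>p\<close>. The interior terms cancel
  since \<open>1 + (d - 1) - d = 0\<close>, so that only indices at the boundary of the ball survive.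
\<close>

lemma ball_poly_mult:
  "[:-d, 1:] * (\<Sum>i\<le>Suc k. nb_poly d i) =
     nb_poly d (Suc (Suc k)) - Polynomial.smult (d - 1) (nb_poly d (Suc k))"
proof (induction k)
  case 0
  show ?case by (simp add: one_pCons)
next
  case (Suc k)
  have "[:-d, 1:] * nb_poly d (Suc (Suc k)) =
     [:0, 1:] * nb_poly d (Suc (Suc k)) - Polynomial.smult d (nb_poly d (Suc (Suc k)))"
    by (simp del: nb_poly.simps)
  then show ?case
    using Suc nb_poly.simps(3)[of d "Suc k"]
    by (simp del: nb_poly.simps add: ring_distribs smult_diff_left)
qed

lemma plus_mult_cheb:
  "[:d, 1:] * cheb_poly (d - 1) (Suc k) =
     (\<Sum>i\<le>Suc (Suc k). nb_poly d i) + Polynomial.smult (d - 1) (\<Sum>i\<le>Suc k. nb_poly d i)"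
  unfolding sum_nb_poly by (simp add: smult_add_right smult_diff_left)

text \<open>
  The analogue for the even-girth choice \<open>w * p = (x + d) * p\<close>: again two high indices survive.
\<close>

lemma sphere_poly_mult:
  "[:-d, 1:] * [:d, 1:] * cheb_poly (d - 1) (Suc k) =
     nb_poly d (Suc (Suc (Suc k))) - Polynomial.smult ((d - 1)\<^sup>2) (nb_poly d (Suc k))"
proof -
  have "[:-d, 1:] * [:d, 1:] * cheb_poly (d - 1) (Suc k) =
    [:-d, 1:] * (\<Sum>i\<le>Suc (Suc k). nb_poly d i) + Polynomial.smult (d - 1) ([:-d, 1:] * (\<Sum>i\<le>Suc k. nb_poly d i))"
    unfolding mult.assoc plus_mult_cheb by (simp only: distrib_left mult_smult_right)
  then show ?thesis
    unfolding ball_poly_mult by (simp del: nb_poly.simps add: smult_diff_right power2_eq_square)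
qed

lemma degree_cheb_poly: "degree (cheb_poly q k) \<le> k"
proof (induction k rule: cheb_poly.induct)
  case (3 q k)
  have "degree ([:0, 1:] * cheb_poly q (Suc k)) \<le> Suc (Suc k)"
    using degree_mult_le[of "[:0, 1:]" "cheb_poly q (Suc k)"] 3(1) by simp
  moreover have "degree (Polynomial.smult q (cheb_poly q k)) \<le> Suc (Suc k)"
    using degree_smult_le[of q "cheb_poly q k"] 3(2) by simp
  ultimately show ?case by (simp only: cheb_poly.simps degree_diff_le)
qed simp_all

lemma poly_cheb_at_degree: "poly (cheb_poly q k) (q + 1) = (\<Sum>j<Suc k. q ^ j)"
  by (induction q k rule: cheb_poly.induct) (simp_all add: algebra_simps)

lemma poly_cheb_trig:
  assumes "q \<ge> 0"
  shows "poly (cheb_poly q k) (2 * sqrt q * cos \<theta>) * sin \<theta> = sqrt q ^ k * sin (real (Suc k) * \<theta>)"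
  using assms
proof (induction q k rule: cheb_poly.induct)
  case (2 q)
  then show ?case by (simp add: sin_double)
next
  case (3 q k)
  have q: "q = sqrt q * sqrt q" using 3(3) by simp
  have s: "sin (real (Suc (Suc (Suc k))) * \<theta>) =
      2 * cos \<theta> * sin (real (Suc (Suc k)) * \<theta>) - sin (real (Suc k) * \<theta>)"
  proof -
    have "real (Suc (Suc (Suc k))) * \<theta> = real (Suc (Suc k)) * \<theta> + \<theta>"
      "real (Suc k) * \<theta> = real (Suc (Suc k)) * \<theta> - \<theta>" by (simp_all add: algebra_simps)
    then show ?thesis by (simp only: sin_add sin_diff) simp
  qed
  have "poly (cheb_poly q (Suc (Suc k))) (2 * sqrt q * cos \<theta>) * sin \<theta> =
     2 * sqrt q * cos \<theta> * (poly (cheb_poly q (Suc k)) (2 * sqrt q * cos \<theta>) * sin \<theta>)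
      - q * (poly (cheb_poly q k) (2 * sqrt q * cos \<theta>) * sin \<theta>)"
    by (simp add: algebra_simps)
  also have "\<dots> = 2 * sqrt q * cos \<theta> * (sqrt q ^ Suc k * sin (real (Suc (Suc k)) * \<theta>))
      - (sqrt q * sqrt q) * (sqrt q ^ k * sin (real (Suc k) * \<theta>))"
    using 3 q by simp
  also have "\<dots> = sqrt q ^ Suc (Suc k) * sin (real (Suc (Suc (Suc k))) * \<theta>)"
    unfolding s by (simp only: power_Suc) (simp only: algebra_simps)
  finally show ?case .
qed simp_all

section \<open>The linear programming argument\<close>

definition spectral_sum :: "real list \<Rightarrow> real poly \<Rightarrow> real" where
  "spectral_sum xs f = (\<Sum>x\<leftarrow>xs. poly f x)"

lemma spectral_sum_linear:
  "spectral_sum xs (f + h) = spectral_sum xs f + spectral_sum xs h"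
  "spectral_sum xs (f - h) = spectral_sum xs f - spectral_sum xs h"
  "spectral_sum xs (Polynomial.smult c f) = c * spectral_sum xs f"
  "spectral_sum xs (\<Sum>i\<in>I. f' i) = (\<Sum>i\<in>I. spectral_sum xs (f' i))"
proof -
  show add: "spectral_sum xs (f + h) = spectral_sum xs f + spectral_sum xs h" for f h
    by (induction xs) (simp_all add: spectral_sum_def)
  show "spectral_sum xs (f - h) = spectral_sum xs f - spectral_sum xs h"
    by (induction xs) (simp_all add: spectral_sum_def)
  show "spectral_sum xs (Polynomial.smult c f) = c * spectral_sum xs f"
    by (induction xs) (simp_all add: spectral_sum_def algebra_simps)
  have "spectral_sum xs 0 = 0" by (induction xs) (simp_all add: spectral_sum_def)
  then show "spectral_sum xs (\<Sum>i\<in>I. f' i) = (\<Sum>i\<in>I. spectral_sum xs (f' i))"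
    by (induction I rule: infinite_finite_induct) (simp_all add: add)
qed

text \<open>
  Multiplication by \<open>x\<close> moves the index \<open>i\<close> by at most one in either direction. The product with
  \<open>s\<close> thus only involves indices from \<open>i - degree s > 0\<close> to \<open>i + degree s < g\<close>.
\<close>

lemma spectral_sum_orthogonal:
  assumes nb: "\<And>k. 1 \<le> k \<Longrightarrow> k < g \<Longrightarrow> spectral_sum xs (nb_poly d k) = 0"
    and "degree s < i" "degree s + i < g"
  shows "spectral_sum xs (nb_poly d i * s) = 0"
proof -
  have mono: "spectral_sum xs (nb_poly d i * monom 1 j) = 0" if "j < i" "j + i < g" for i j
    using that
  proof (induction j arbitrary: i)
    case 0
    then show ?case using nb[of i] by simp
  next
    case (Suc j)
    then obtain k where k: "i = Suc (Suc k)"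
      by (metis Suc_less_eq2 less_imp_Suc_add add_Suc)
    let ?c = "if Suc k = 0 then d else d - 1"
    have "[:0, 1:] * nb_poly d i = nb_poly d (Suc i) + Polynomial.smult ?c (nb_poly d (Suc k))"
      unfolding k by simp
    moreover have "nb_poly d i * monom 1 (Suc j) = ([:0, 1:] * nb_poly d i) * monom 1 j"
      by (simp add: monom_Suc del: nb_poly.simps)
    ultimately have "spectral_sum xs (nb_poly d i * monom 1 (Suc j)) =
        spectral_sum xs (nb_poly d (Suc i) * monom 1 j) +
        ?c * spectral_sum xs (nb_poly d (Suc k) * monom 1 j)"
      by (simp only: distrib_right mult_smult_left spectral_sum_linear)
    then show ?case using Suc.IH[of "Suc i"] Suc.IH[of "Suc k"] Suc.prems k by simp
  qed
  have "nb_poly d i * s = nb_poly d i * (\<Sum>j\<le>degree s. monom (coeff s j) j)"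
    by (simp only: poly_as_sum_of_monoms)
  also have "\<dots> = (\<Sum>j\<le>degree s. Polynomial.smult (coeff s j) (nb_poly d i * monom 1 j))"
    unfolding sum_distrib_left by (intro sum.cong refl) (simp add: smult_monom mult_smult_right [symmetric])
  finally show ?thesis
    using assms(2,3) by (simp add: spectral_sum_linear mono)
qed

text \<open>
  The two opposite inequalities come from the test polynomials \<open>s = p\<close> and \<open>s = p / (x - \<tau>)\<close>, for
  which the contribution of \<open>xs\<close> to the sum has a definite sign.
\<close>

lemma reproducing_imp_count:
  assumes repr: "\<And>s. degree s \<le> m \<Longrightarrow> spectral_sum (d # xs) (w * p * s) = c * poly s d"
    and deg: "degree p \<le> m" and pd: "poly p d > 0"
    and w: "\<And>x. x \<in> set xs \<Longrightarrow> poly w x \<ge> 0"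
    and root: "poly p \<tau> = 0" "\<tau> < d" and le: "\<And>x. x \<in> set xs \<Longrightarrow> x \<le> \<tau>"
  shows "c = poly w d * poly p d"
proof (rule antisym)
  have "poly w d * poly p d * poly p d \<le> c * poly p d"
  proof -
    have "0 \<le> (\<Sum>x\<leftarrow>xs. poly (w * p * p) x)"
      by (rule sum_list_nonneg) (auto simp: w mult.assoc)
    then show ?thesis using repr[OF deg] by (simp add: spectral_sum_def)
  qed
  then show "poly w d * poly p d \<le> c" using pd by simp
next
  obtain h where h: "p = [:-\<tau>, 1:] * h" using root(1) by (auto simp: poly_eq_0_iff_dvd)
  have "h \<noteq> 0" using pd h by auto
  then have dh: "degree h \<le> m" 
    using deg degree_mult_eq[of "[:-\<tau>, 1:]" h] unfolding h by (simp del: mult_pCons_left)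
  have hd: "poly h d > 0"
  proof -
    have "(d - \<tau>) * poly h d > 0" using pd unfolding h by (simp add: algebra_simps)
    then show ?thesis using root(2) by (simp add: zero_less_mult_iff)
  qed
  have "(\<Sum>x\<leftarrow>xs. poly (w * p * h) x) \<le> 0"
  proof (rule sum_list_nonpos)
    fix y assume "y \<in> set (map (poly (w * p * h)) xs)"
    then obtain x where x: "x \<in> set xs" and y: "y = poly (w * p * h) x" by auto
    have "y = poly w x * ((x - \<tau>) * (poly h x)\<^sup>2)"
      unfolding y h by (simp add: algebra_simps power2_eq_square)
    also have "\<dots> \<le> 0"
      using w[OF x] le[OF x] by (simp add: mult_nonneg_nonpos mult_nonpos_nonneg)
    finally show "y \<le> 0" .
  qed
  then have "c * poly h d \<le> poly w d * poly p d * poly h d"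
    using repr[OF dh] by (simp add: spectral_sum_def)
  then show "c \<le> poly w d * poly p d" using hd by simp
qed

text \<open>
  Write \<open>s = s(d) + (x - d) * r\<close>.
\<close>

lemma reproducingI:
  assumes wp: "spectral_sum xs u = c"
    and orth: "\<And>r. degree r < m \<Longrightarrow> spectral_sum xs ([:-d, 1:] * u * r) = 0"
    and s: "degree s \<le> m"
  shows "spectral_sum xs (u * s) = c * poly s d"
proof -
  have "[:-d, 1:] dvd s - [:poly s d:]" by (simp add: poly_eq_0_iff_dvd [symmetric])
  then obtain r where "s - [:poly s d:] = [:-d, 1:] * r" by (elim dvdE)
  then have r: "s = [:poly s d:] + [:-d, 1:] * r" by (simp add: algebra_simps)
  have "r = 0 \<or> degree r < m"
  proof (cases "r = 0")
    case False
    then have "degree ([:-d, 1:] * r) = Suc (degree r)"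
      using degree_mult_eq[of "[:-d, 1:]" r] by (simp del: mult_pCons_left)
    then have "degree s = Suc (degree r)"
      by (subst r) (simp add: degree_add_eq_right)
    then show ?thesis using s by simp
  qed simp
  then have "spectral_sum xs ([:-d, 1:] * u * r) = 0"
    using orth by (auto simp: spectral_sum_def)
  moreover have "u * s = Polynomial.smult (poly s d) u + [:-d, 1:] * u * r"
    by (subst r) (simp add: algebra_simps)
  ultimately show ?thesis using wp by (simp only: spectral_sum_linear) simp
qed

lemma spectral_sum_nb_poly_0: "spectral_sum xs (nb_poly d 0) = real (length xs)"
  by (induction xs) (simp_all add: spectral_sum_def)

lemma spectral_sum_ball_poly:
  assumes nb: "\<And>k. 1 \<le> k \<Longrightarrow> k < g \<Longrightarrow> spectral_sum xs (nb_poly d k) = 0" and "k < g"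
  shows "spectral_sum xs (\<Sum>i\<le>k. nb_poly d i) = real (length xs)"
proof -
  have "(\<Sum>i\<le>k. spectral_sum xs (nb_poly d i)) = (\<Sum>i\<in>{0}. spectral_sum xs (nb_poly d i))"
    using assms by (intro sum.mono_neutral_right) auto
  then show ?thesis by (simp add: spectral_sum_linear spectral_sum_nb_poly_0 del: nb_poly.simps)
qed

text \<open>
  Here \<open>p = F\<^sub>0 + \<dots> + F\<^sub>K\<close> with \<open>K = Suc k'\<close>. The orthogonality
  of \<open>F\<^bsub>K+1\<^esub>\<close> and \<open>F\<^sub>K\<close> to polynomials of degree below \<open>K\<close> involves indices up to \<open>2 * K\<close>, the
  last one below the girth \<open>2 * K + 1\<close>.
\<close>

lemma count_odd_girth:
  assumes nb: "\<And>k. 1 \<le> k \<Longrightarrow> k < 2 * Suc k' + 1 \<Longrightarrow> spectral_sum (d # xs) (nb_poly d k) = 0"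
    and d: "d \<ge> 1"
    and root: "poly (cheb_poly (d - 1) (Suc k') + cheb_poly (d - 1) k') \<tau> = 0" "\<tau> < d"
    and le: "\<And>x. x \<in> set xs \<Longrightarrow> x \<le> \<tau>"
  shows "real (length (d # xs)) = 1 + d * (\<Sum>j<Suc k'. (d - 1) ^ j)"
proof -
  let ?G = "\<Sum>i\<le>Suc k'. nb_poly d i"
  have cheb: "poly (cheb_poly (d - 1) k) d = (\<Sum>j<Suc k. (d - 1) ^ j)" for k
    using poly_cheb_at_degree[of "d - 1" k] by simp
  have val: "poly ?G d = 1 + d * (\<Sum>j<Suc k'. (d - 1) ^ j)"
  proof -
    have "(\<Sum>j<Suc (Suc k'). (d - 1) ^ j) = 1 + (d - 1) * (\<Sum>j<Suc k'. (d - 1) ^ j)"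
      by (subst sum.lessThan_Suc_shift) (simp add: sum_distrib_left del: sum.lessThan_Suc)
    then show ?thesis
      unfolding sum_nb_poly by (simp add: cheb algebra_simps del: sum.lessThan_Suc)
  qed
  have "real (length (d # xs)) = poly 1 d * poly ?G d"
  proof (rule reproducing_imp_count[where m = "Suc k'" and \<tau> = \<tau>])
    fix s :: "real poly" assume s: "degree s \<le> Suc k'"
    have "spectral_sum (d # xs) (?G * s) = real (length (d # xs)) * poly s d"
    proof (rule reproducingI[OF _ _ s])
      show "spectral_sum (d # xs) ?G = real (length (d # xs))"
        by (rule spectral_sum_ball_poly[OF nb]) auto
    next
      fix r :: "real poly" assume r: "degree r < Suc k'"
      have "[:-d, 1:] * ?G * r =
          nb_poly d (Suc (Suc k')) * r - Polynomial.smult (d - 1) (nb_poly d (Suc k') * r)"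
        unfolding ball_poly_mult by (simp only: left_diff_distrib mult_smult_left)
      moreover have "spectral_sum (d # xs) (nb_poly d (Suc (Suc k')) * r) = 0"
        "spectral_sum (d # xs) (nb_poly d (Suc k') * r) = 0"
        by (rule spectral_sum_orthogonal[OF nb]; use r in auto)+
      ultimately show "spectral_sum (d # xs) ([:-d, 1:] * ?G * r) = 0"
        by (simp only: spectral_sum_linear)
    qed
    then show "spectral_sum (d # xs) (1 * ?G * s) = real (length (d # xs)) * poly s d"
      by (simp only: mult_1_left)
  next
    show "degree ?G \<le> Suc k'"
      unfolding sum_nb_poly
      using degree_cheb_poly[of "d - 1" "Suc k'"] degree_cheb_poly[of "d - 1" k']
      by (intro degree_add_le) simp_all
  next
    show "poly ?G d > 0"
      unfolding val using d
      by (intro add_pos_nonneg mult_nonneg_nonneg sum_nonneg) simp_all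
  next
    show "poly ?G \<tau> = 0" using root(1) unfolding sum_nb_poly .
  qed (use root(2) le in simp_all)
  then show ?thesis unfolding val by simp
qed

text \<open>
  The weight \<open>x + d\<close> is nonnegative on the spectrum, and the extra degree is paid for by the
  girth \<open>2 * K\<close>, one more than the \<open>2 * (K - 1) + 1\<close> that \<open>degree p = K - 1\<close> needs without a weight;
  here \<open>K = Suc (Suc k')\<close>. Moore graphs
  of even girth are bipartite; the weight vanishes at their eigenvalue \<open>- d\<close>, which would otherwise
  spoil the equality.
\<close>

lemma count_even_girth:
  assumes nb: "\<And>k. 1 \<le> k \<Longrightarrow> k < 2 * Suc (Suc k') \<Longrightarrow> spectral_sum (d # xs) (nb_poly d k) = 0"
    and d: "d \<ge> 1"
    and root: "poly (cheb_poly (d - 1) (Suc k')) \<tau> = 0" "\<tau> < d"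
    and le: "\<And>x. x \<in> set xs \<Longrightarrow> - d \<le> x \<and> x \<le> \<tau>"
  shows "real (length (d # xs)) = 2 * (\<Sum>j<Suc (Suc k'). (d - 1) ^ j)"
proof -
  let ?P = "cheb_poly (d - 1) (Suc k')" and ?N = "real (length (d # xs))"
  have val: "poly ?P d = (\<Sum>j<Suc (Suc k'). (d - 1) ^ j)"
    using poly_cheb_at_degree[of "d - 1" "Suc k'"] by simp
  have "d * ?N = poly [:d, 1:] d * poly ?P d"
  proof (rule reproducing_imp_count[where m = "Suc k'" and \<tau> = \<tau>])
    fix s :: "real poly" assume s: "degree s \<le> Suc k'"
    show "spectral_sum (d # xs) ([:d, 1:] * ?P * s) = d * ?N * poly s d"
    proof (rule reproducingI[OF _ _ s])
      have "spectral_sum (d # xs) (\<Sum>i\<le>k. nb_poly d i) = ?N" if "k \<le> Suc (Suc k')" for k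
        by (rule spectral_sum_ball_poly[OF nb]) (use that in auto)
      then show "spectral_sum (d # xs) ([:d, 1:] * ?P) = d * ?N"
        unfolding plus_mult_cheb by (simp only: spectral_sum_linear) (simp add: algebra_simps)
    next
      fix r :: "real poly" assume r: "degree r < Suc k'"
      have "[:-d, 1:] * ([:d, 1:] * ?P) * r =
          nb_poly d (Suc (Suc (Suc k'))) * r - Polynomial.smult ((d - 1)\<^sup>2) (nb_poly d (Suc k') * r)"
        using sphere_poly_mult[of d k'] by (simp only: mult.assoc [symmetric] left_diff_distrib mult_smult_left)
      moreover have "spectral_sum (d # xs) (nb_poly d (Suc (Suc (Suc k'))) * r) = 0"
        "spectral_sum (d # xs) (nb_poly d (Suc k') * r) = 0"
        by (rule spectral_sum_orthogonal[OF nb]; use r in auto)+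
      ultimately show "spectral_sum (d # xs) ([:-d, 1:] * ([:d, 1:] * ?P) * r) = 0"
        by (simp only: spectral_sum_linear)
    qed
  next
    have "0 < (\<Sum>j<Suc k'. (d - 1) ^ Suc j) + 1"
      using d by (intro add_nonneg_pos sum_nonneg) simp_all
    then show "poly ?P d > 0"
      unfolding val sum.lessThan_Suc_shift by (simp add: add.commute)
  next
    show "poly [:d, 1:] x \<ge> 0" if "x \<in> set xs" for x using le[OF that] by simp
  qed (use root le degree_cheb_poly in auto)
  then show ?thesis using d unfolding val by simp
qed

section \<open>The girth angle\<close>

lemma moore_value_less_degree:
  assumes "d \<ge> 2" "sin \<theta> \<noteq> 0"
  shows "2 * sqrt (d - 1) * cos \<theta> < d"
proof -
  have "cos \<theta> < 1"
  proof -
    have "cos \<theta> \<noteq> 1" using assms(2) cos_one_sin_zero by blast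
    then show ?thesis using cos_le_one[of \<theta>] by linarith
  qed
  then have "2 * sqrt (d - 1) * cos \<theta> < 2 * sqrt (d - 1) * 1"
    using assms(1) by (intro mult_strict_left_mono) simp_all
  also have "\<dots> \<le> (d - 1) + 1"
    using arith_geo_mean_sqrt[of "d - 1" 1] assms(1) by simp
  finally show ?thesis by simp
qed

lemma even_girth_root:
  fixes k :: nat
  assumes "q \<ge> 0"
  defines "\<theta> \<equiv> pi / real (Suc (Suc k))"
  shows "sin \<theta> > 0" "poly (cheb_poly q (Suc k)) (2 * sqrt q * cos \<theta>) = 0"
proof -
  show s: "sin \<theta> > 0"
    unfolding \<theta>_def using pi_gt_zero
    by (intro sin_gt_zero divide_pos_pos) (simp_all add: divide_less_eq add_pos_nonneg)
  have "poly (cheb_poly q (Suc k)) (2 * sqrt q * cos \<theta>) * sin \<theta> = sqrt q ^ Suc k * sin pi"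
    unfolding poly_cheb_trig[OF assms(1)] by (simp add: \<theta>_def)
  then show "poly (cheb_poly q (Suc k)) (2 * sqrt q * cos \<theta>) = 0" using s by simp
qed

text \<open>
  Where this expression vanishes and \<open>sin \<theta> \<noteq> 0\<close>, so does the bracket. Dividing the
  bracket by \<open>cos (\<theta> * Suc k)\<close> and \<open>q powr (-1/2) + cos \<theta>\<close> gives the equation that defines the
  odd-girth angle.
\<close>

lemma odd_poly_trig:
  assumes "q > 0"
  shows "poly (cheb_poly q (Suc k) + cheb_poly q k) (2 * sqrt q * cos \<theta>) * sin \<theta> =
     sqrt q ^ Suc k * (sin (\<theta> * real (Suc k)) * (q powr (-1/2) + cos \<theta>) + cos (\<theta> * real (Suc k)) * sin \<theta>)"
proof -
  have "sqrt q * q powr (-1/2) = 1"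
    using assms by (simp add: powr_minus powr_half_sqrt)
  then have e: "sqrt q ^ k = sqrt q ^ Suc k * q powr (-1/2)" by (simp add: mult.assoc)
  have a: "sin (real (Suc (Suc k)) * \<theta>) =
      sin (\<theta> * real (Suc k)) * cos \<theta> + cos (\<theta> * real (Suc k)) * sin \<theta>"
  proof -
    have "real (Suc (Suc k)) * \<theta> = \<theta> * real (Suc k) + \<theta>" by (simp add: algebra_simps)
    then show ?thesis by (simp only: sin_add)
  qed
  have q: "0 \<le> q" using assms by simp
  have "poly (cheb_poly q (Suc k) + cheb_poly q k) (2 * sqrt q * cos \<theta>) * sin \<theta> =
      sqrt q ^ Suc k * sin (real (Suc (Suc k)) * \<theta>) + sqrt q ^ k * sin (real (Suc k) * \<theta>)"
    unfolding poly_add distrib_right poly_cheb_trig[OF q] ..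
  also have "\<dots> = sqrt q ^ Suc k * (sin (\<theta> * real (Suc k)) * cos \<theta> + cos (\<theta> * real (Suc k)) * sin \<theta>) +
      sqrt q ^ Suc k * q powr (-1/2) * sin (\<theta> * real (Suc k))"
    unfolding a e[symmetric] by (simp add: mult.commute)
  finally show ?thesis by (simp add: algebra_simps)
qed

lemma odd_girth_rootD:
  assumes "odd_girth_root d (Suc k) \<theta>" "d \<ge> 2" "sin \<theta> \<noteq> 0"
  shows "poly (cheb_poly (real d - 1) (Suc k) + cheb_poly (real d - 1) k) (2 * sqrt (real d - 1) * cos \<theta>) = 0"
proof -
  have "sin (\<theta> * real (Suc k)) * ((real d - 1) powr (-1/2) + cos \<theta>) + cos (\<theta> * real (Suc k)) * sin \<theta> = 0"
  proof -
    have eq: "s * (c + x) + y * t = 0" if "y \<noteq> 0" "c + x \<noteq> 0" "s / y = - (t / (c + x))" for s c x y t :: real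
      using that by (simp add: field_simps)
    show ?thesis using assms(1) unfolding odd_girth_root_def tan_def by (elim conjE) (rule eq)
  qed
  then show ?thesis using odd_poly_trig[of "real d - 1" k \<theta>] assms(2,3) by simp
qed

lemma odd_girth_rootI:
  assumes "poly (cheb_poly (real d - 1) (Suc k) + cheb_poly (real d - 1) k) (2 * sqrt (real d - 1) * cos \<theta>) = 0"
    and d: "d \<ge> 2" and "sin \<theta> \<noteq> 0" and c: "cos (\<theta> * real (Suc k)) \<noteq> 0"
  shows "odd_girth_root d (Suc k) \<theta>"
proof -
  have *: "sin (\<theta> * real (Suc k)) * ((real d - 1) powr (-1/2) + cos \<theta>) + cos (\<theta> * real (Suc k)) * sin \<theta> = 0"
    using odd_poly_trig[of "real d - 1" k \<theta>] assms by simp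
  moreover from * have "(real d - 1) powr (-1/2) + cos \<theta> \<noteq> 0" using assms by auto
  moreover have "s / y = - (t / (c + x))" if "y \<noteq> 0" "c + x \<noteq> 0" "s * (c + x) + y * t = 0" for s c x y t :: real
    using that by (simp add: field_simps)
  ultimately show ?thesis
    using c unfolding odd_girth_root_def tan_def by blast
qed

text \<open>
  The least root could a priori be \<open>\<theta> = \<pi>\<close>, where both sides of the defining equation vanish without
  \<open>p\<close> having a root. A root strictly below \<open>\<pi>\<close> rules this out. It lies between \<open>\<pi> / (K + 1)\<close> and
  \<open>\<pi> / K\<close>, where \<open>p\<close> changes sign; this interval also keeps \<open>\<theta> * K\<close> in \<open>(\<pi> / 2, \<pi>)\<close>, so
  that the tangent is defined.
\<close>

lemma ex_odd_girth_root:
  assumes d: "d \<ge> 2"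
  shows "\<exists>\<theta>. 0 < \<theta> \<and> \<theta> < pi \<and> odd_girth_root d (Suc k) \<theta>"
proof -
  define q where "q = real d - 1"
  have q: "q \<ge> 1" using d by (simp add: q_def)
  define f where "f \<theta> = poly (cheb_poly q (Suc k) + cheb_poly q k) (2 * sqrt q * cos \<theta>)" for \<theta>
  let ?a = "pi / real (Suc (Suc k))" and ?b = "pi / real (Suc k)"
  have ab: "0 < ?a" "?a < ?b" "?b \<le> pi" by (simp_all add: field_simps)
  have fa: "f ?a > 0"
  proof -
    have s: "sin ?a > 0" and z: "poly (cheb_poly q (Suc k)) (2 * sqrt q * cos ?a) = 0"
      using even_girth_root[of q k] q by simp_all
    have "real (Suc k) * ?a = pi - ?a" by (simp add: field_simps)
    then have "f ?a * sin ?a = sqrt q ^ k * sin ?a"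
      using poly_cheb_trig[of q k ?a] z q by (simp add: f_def)
    then show ?thesis using s q by simp
  qed
  have fb: "f ?b < 0"
  proof (cases k)
    case 0
    have "2 * sqrt q > 1" using real_sqrt_ge_one[OF q] by linarith
    then show ?thesis by (simp add: f_def 0)
  next
    case (Suc l)
    have s: "sin ?b > 0" and z: "poly (cheb_poly q k) (2 * sqrt q * cos ?b) = 0"
      using even_girth_root[of q l] q Suc by simp_all
    have "real (Suc (Suc k)) * ?b = pi + ?b" by (simp add: field_simps)
    then have "f ?b * sin ?b = sqrt q ^ Suc k * - sin ?b"
      using poly_cheb_trig[of q "Suc k" ?b] z q by (simp add: f_def)
    then have "f ?b * sin ?b < 0" using s q by (simp add: mult_less_0_iff)
    then show ?thesis using s by (simp add: mult_less_0_iff)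
  qed
  have "\<exists>\<theta>\<ge>?a. \<theta> \<le> ?b \<and> f \<theta> = 0"
  proof (rule IVT2')
    show "continuous_on {?a..?b} f" unfolding f_def by (intro continuous_intros)
  qed (use fa fb ab in linarith)+
  then obtain \<theta> where "?a \<le> \<theta>" "\<theta> \<le> ?b" "f \<theta> = 0" by blast
  moreover from this have "?a \<noteq> \<theta>" "?b \<noteq> \<theta>" using fa fb by auto
  ultimately have \<theta>: "?a < \<theta>" "\<theta> < ?b" "f \<theta> = 0" by auto
  then have "0 < \<theta>" "\<theta> < pi" using ab by linarith+
  moreover have "cos (\<theta> * real (Suc k)) < cos (pi / 2)"
  proof (rule cos_monotone_0_pi)
    have "pi / 2 \<le> ?a * real (Suc k)" by (simp add: field_simps)
    also have "\<dots> < \<theta> * real (Suc k)" using \<theta>(1) by (intro mult_strict_right_mono) simp_all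
    finally show "pi / 2 < \<theta> * real (Suc k)" .
    have "\<theta> * real (Suc k) < ?b * real (Suc k)"
      using \<theta>(2) by (intro mult_strict_right_mono) simp_all
    then show "\<theta> * real (Suc k) \<le> pi" by simp
  qed simp
  ultimately show ?thesis
    using odd_girth_rootI[of d k \<theta>] d \<theta>(3) sin_gt_zero[of \<theta>] unfolding f_def q_def
    by (intro exI[of _ \<theta>]) auto
qed

lemma girth_angle_sin_pos:
  assumes "girth_angle d g \<theta>" "d \<ge> 2" "g \<ge> 3"
  shows "sin \<theta> > 0"
proof (cases "even g")
  case True
  then obtain k where k: "g div 2 = Suc (Suc k)" using assms(3)
    by (cases "g div 2"; cases "g div 2 - 1") auto
  show ?thesis using assms(1) True even_girth_root(1)[of 1 k] by (simp add: girth_angle_def k)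
next
  case False
  then obtain k where k: "g div 2 = Suc k" using assms(3) by (cases "g div 2") auto
  obtain \<phi> where "0 < \<phi>" "\<phi> < pi" "odd_girth_root d (Suc k) \<phi>"
    using ex_odd_girth_root[OF assms(2)] by blast
  then have "0 < \<theta>" "\<theta> < pi"
    using assms(1) False k by (auto simp: girth_angle_def intro: le_less_trans)
  then show ?thesis by (rule sin_gt_zero)
qed

lemma count_eq_moore_bound:
  assumes nb: "\<And>k. 1 \<le> k \<Longrightarrow> k < g \<Longrightarrow> spectral_sum (real d # xs) (nb_poly d k) = 0"
    and "d \<ge> 2" "g \<ge> 3" "girth_angle d g \<theta>"
    and le: "\<And>x. x \<in> set xs \<Longrightarrow> - real d \<le> x \<and> x \<le> 2 * sqrt (real d - 1) * cos \<theta>"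
  shows "length (real d # xs) = moore_bound d g"
proof -
  have s: "sin \<theta> > 0" by (rule girth_angle_sin_pos[OF assms(4,2,3)])
  have lt: "2 * sqrt (real d - 1) * cos \<theta> < real d"
    using s assms(2) by (intro moore_value_less_degree) simp_all
  have of_q: "(\<Sum>j<k. (real d - 1) ^ j) = real (\<Sum>j<k. (d - 1) ^ j)" for k
    using assms(2) by (simp add: of_nat_diff)
  have "real (length (real d # xs)) = real (moore_bound d g)"
  proof (cases "even g")
    case True
    then obtain m where m: "g = 2 * m" by blast
    with assms(3) have "m \<ge> 2" by simp
    then obtain k where k: "m = Suc (Suc k)" by (metis add_2_eq_Suc less_eqE)
    have "\<theta> = pi / real (Suc (Suc k))" using assms(4) True by (simp add: girth_angle_def m k)
    then have "poly (cheb_poly (real d - 1) (Suc k)) (2 * sqrt (real d - 1) * cos \<theta>) = 0"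
      using even_girth_root(2)[of "real d - 1" k] assms(2) by simp
    then have "real (length (real d # xs)) = 2 * (\<Sum>j<Suc (Suc k). (real d - 1) ^ j)"
      using nb assms(2) lt le unfolding m k by (intro count_even_girth) auto
    then show ?thesis
      unfolding of_q moore_bound_def m k by (simp del: sum.lessThan_Suc)
  next
    case False
    then obtain m where m: "g = 2 * m + 1" by (elim oddE)
    with assms(3) obtain k where k: "m = Suc k" by (cases m) auto
    have "odd_girth_root d (Suc k) \<theta>" using assms(4) False by (simp add: girth_angle_def m k)
    from odd_girth_rootD[OF this assms(2)]
    have "poly (cheb_poly (real d - 1) (Suc k) + cheb_poly (real d - 1) k) (2 * sqrt (real d - 1) * cos \<theta>) = 0"
      using s by simp
    then have "real (length (real d # xs)) = 1 + real d * (\<Sum>j<Suc k. (real d - 1) ^ j)"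
      using nb assms(2) lt le unfolding m k by (intro count_odd_girth) auto
    then show ?thesis
      unfolding of_q moore_bound_def m k by (simp del: sum.lessThan_Suc)
  qed
  then show ?thesis by (simp only: of_nat_eq_iff)
qed

section \<open>Symmetric matrices and traces\<close>

lemma mat_mult_entry:
  assumes "A \<in> carrier_mat n n" "B \<in> carrier_mat n n" "i < n" "j < n"
  shows "(A * B) $$ (i, j) = (\<Sum>k<n. A $$ (i, k) * B $$ (k, j))"
  using assms by (simp add: scalar_prod_def atLeast0LessThan)

lemma eigenvector_entry:
  assumes "A \<in> carrier_mat n n" "eigenvector A v e" "i < n"
  shows "(\<Sum>j<n. A $$ (i, j) * v $ j) = e * v $ i"
proof -
  have v: "v \<in> carrier_vec n" "A *\<^sub>v v = e \<cdot>\<^sub>v v"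
    using assms unfolding eigenvector_def by auto
  have "(A *\<^sub>v v) $ i = e * v $ i" unfolding v(2) using v(1) assms(3) by simp
  then show ?thesis
    using v(1) assms(1,3) by (simp add: scalar_prod_def atLeast0LessThan)
qed

text \<open>
  The Hermitian form \<open>v\<^sup>* A v\<close> is real and equals \<open>a\<close> times the squared norm of \<open>v\<close>.
\<close>

lemma symmetric_eigenvalue_real:
  fixes A :: "real mat"
  assumes A: "A \<in> carrier_mat n n"
    and sym: "\<And>i j. i < n \<Longrightarrow> j < n \<Longrightarrow> A $$ (i, j) = A $$ (j, i)"
    and ev: "eigenvalue (map_mat complex_of_real A) a"
  shows "a = complex_of_real (Re a)"
proof -
  let ?C = "map_mat complex_of_real A"
  have C: "?C \<in> carrier_mat n n" using A by simp
  obtain v where v: "eigenvector ?C v a" using ev unfolding eigenvalue_def by blast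
  then have vn: "v \<in> carrier_vec n" and v0: "v \<noteq> 0\<^sub>v n"
    using A unfolding eigenvector_def by auto
  obtain i where i: "i < n" "v $ i \<noteq> 0"
    using v0 vn by (metis carrier_vecD eq_vecI index_zero_vec(1,2))
  define S where "S = (\<Sum>i<n. (cmod (v $ i))\<^sup>2)"
  have S: "S > 0"
    unfolding S_def using i by (intro sum_pos2[where i = i]) auto
  let ?h = "\<Sum>i<n. \<Sum>j<n. cnj (v $ i) * (complex_of_real (A $$ (i, j)) * v $ j)"
  have "?h = (\<Sum>i<n. cnj (v $ i) * (a * v $ i))"
  proof (intro sum.cong refl)
    fix i assume "i \<in> {..<n}"
    then have "i < n" by simp
    from eigenvector_entry[OF C v this]
    have "(\<Sum>j<n. complex_of_real (A $$ (i, j)) * v $ j) = a * v $ i"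
      using A \<open>i < n\<close> by simp
    then show "(\<Sum>j<n. cnj (v $ i) * (complex_of_real (A $$ (i, j)) * v $ j)) = cnj (v $ i) * (a * v $ i)"
      by (simp only: sum_distrib_left [symmetric])
  qed
  also have "\<dots> = a * complex_of_real S"
    unfolding S_def of_real_sum sum_distrib_left
    by (intro sum.cong refl) (simp only: complex_norm_square, simp add: mult_ac)
  finally have h: "?h = a * complex_of_real S" .
  have "cnj ?h = (\<Sum>i<n. \<Sum>j<n. cnj (v $ j) * (complex_of_real (A $$ (j, i)) * v $ i))"
    by (simp add: sym mult_ac)
  also have "\<dots> = ?h" by (rule sum.swap)
  finally have "cnj ?h = ?h" .
  then have "cnj a = a" unfolding h using S by simp
  then show ?thesis by (metis Reals_cnj_iff of_real_Re)
qed

lemma symmetric_char_poly_splits: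
  fixes A :: "real mat"
  assumes A: "A \<in> carrier_mat n n"
    and sym: "\<And>i j. i < n \<Longrightarrow> j < n \<Longrightarrow> A $$ (i, j) = A $$ (j, i)"
  shows "\<exists>es. char_poly A = (\<Prod>e\<leftarrow>es. [:- e, 1:]) \<and> length es = n"
proof -
  interpret poly_hom: map_poly_inj_idom_hom complex_of_real ..
  let ?C = "map_mat complex_of_real A"
  have C: "?C \<in> carrier_mat n n" using A by simp
  obtain as where as: "char_poly ?C = (\<Prod>a\<leftarrow>as. [:- a, 1:])" "length as = n"
    using char_poly_factorized[OF C] by blast
  have re: "a = complex_of_real (Re a)" if "a \<in> set as" for a
  proof (rule symmetric_eigenvalue_real[OF A sym])
    show "eigenvalue ?C a"
      unfolding eigenvalue_root_char_poly[OF C] as(1) using that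
      by (simp add: poly_prod_list prod_list_zero_iff)
  qed auto
  define es where "es = map Re as"
  have "as = map complex_of_real es" unfolding es_def using re by (simp add: map_idI)
  moreover have "char_poly ?C = map_poly complex_of_real (char_poly A)"
    by (rule of_real_hom.char_poly_hom[OF A])
  ultimately have "map_poly complex_of_real (char_poly A) = (\<Prod>e\<leftarrow>es. [:- complex_of_real e, 1:])"
    using as(1) by (simp add: comp_def)
  also have "\<dots> = map_poly complex_of_real (\<Prod>e\<leftarrow>es. [:- e, 1:])"
    by (induction es) (simp_all add: poly_hom.hom_mult del: mult_pCons_left)
  finally have "char_poly A = (\<Prod>e\<leftarrow>es. [:- e, 1:])"
    by (rule poly_hom.injectivity)
  moreover have "length es = n" using as(2) by (simp add: es_def)
  ultimately show ?thesis by blast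
qed

definition mat_trace :: "real mat \<Rightarrow> real" where
  "mat_trace A = (\<Sum>i<dim_row A. A $$ (i, i))"

lemma mat_trace_commute:
  assumes "A \<in> carrier_mat n n" "B \<in> carrier_mat n n"
  shows "mat_trace (A * B) = mat_trace (B * A)"
proof -
  have "mat_trace (A * B) = (\<Sum>i<n. \<Sum>k<n. A $$ (i, k) * B $$ (k, i))"
    using assms mat_mult_entry[OF assms] by (simp add: mat_trace_def)
  also have "\<dots> = (\<Sum>k<n. \<Sum>i<n. A $$ (i, k) * B $$ (k, i))" by (rule sum.swap)
  also have "\<dots> = mat_trace (B * A)"
    using assms mat_mult_entry[OF assms(2,1)] by (simp add: mat_trace_def mult.commute)
  finally show ?thesis .
qed

lemma upper_triangular_mult:
  assumes A: "A \<in> carrier_mat n n" "upper_triangular A" and B: "B \<in> carrier_mat n n" "upper_triangular B"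
  shows "upper_triangular (A * B :: real mat)"
    and "i < n \<Longrightarrow> (A * B) $$ (i, i) = A $$ (i, i) * B $$ (i, i)"
proof -
  show "upper_triangular (A * B)"
  proof
    fix i j assume ij: "j < i" "i < dim_row (A * B)"
    then have *: "i < n" "j < n" using A by auto
    have "A $$ (i, k) * B $$ (k, j) = 0" if "k < n" for k
      using upper_triangularD[OF A(2), of k i] upper_triangularD[OF B(2), of j k] A(1) B(1) ij * that
      by (cases "k < i") auto
    then show "(A * B) $$ (i, j) = 0"
      unfolding mat_mult_entry[OF A(1) B(1) *] by (intro sum.neutral) simp
  qed
next
  assume i: "i < n"
  have "A $$ (i, k) * B $$ (k, i) = 0" if "k \<in> {..<n} - {i}" for k
    using upper_triangularD[OF A(2), of k i] upper_triangularD[OF B(2), of i k] A(1) B(1) i that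
    by (cases "k < i") auto
  then have "(\<Sum>k<n. A $$ (i, k) * B $$ (k, i)) = (\<Sum>k\<in>{i}. A $$ (i, k) * B $$ (k, i))"
    using i by (intro sum.mono_neutral_right) auto
  then show "(A * B) $$ (i, i) = A $$ (i, i) * B $$ (i, i)"
    by (simp add: mat_mult_entry[OF A(1) B(1) i i])
qed

text \<open>
  Conjugation by the matrices of the Schur decomposition of \<open>L\<close> makes all the \<open>N k\<close> upper
  triangular at once, with the values of the polynomials at the eigenvalues on the diagonal.
\<close>

lemma trace_nb_poly:
  fixes L A :: "real mat"
  assumes L: "L \<in> carrier_mat n n" and cp: "char_poly L = (\<Prod>e\<leftarrow>es. [:- e, 1:])"
    and A: "A = d \<cdot>\<^sub>m 1\<^sub>m n - L"
    and N0: "N 0 = 1\<^sub>m n" and N1: "N (Suc 0) = A"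
    and N: "\<And>k. N (Suc (Suc k)) = A * N (Suc k) - (if k = 0 then d else d - 1) \<cdot>\<^sub>m N k"
  shows "mat_trace (N k) = spectral_sum (map (\<lambda>e. d - e) es) (nb_poly d k)"
proof -
  obtain B P Q where BPQ: "schur_decomposition L es = (B, P, Q)" by (cases "schur_decomposition L es")
  from schur_decomposition[OF L cp BPQ]
  have wit: "similar_mat_wit L B P Q" and ut: "upper_triangular B" and diag: "diag_mat B = es" by auto
  from similar_mat_witD2[OF L wit]
  have PQ: "P * Q = 1\<^sub>m n" and QP: "Q * P = 1\<^sub>m n" and LB: "L = P * B * Q"
    and B: "B \<in> carrier_mat n n" and P: "P \<in> carrier_mat n n" and Q: "Q \<in> carrier_mat n n" by auto
  have len: "length es = n" and esi: "\<And>i. i < n \<Longrightarrow> es ! i = B $$ (i, i)"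
    using B unfolding diag[symmetric] diag_mat_def by auto
  define T where "T = d \<cdot>\<^sub>m 1\<^sub>m n - B"
  have T: "T \<in> carrier_mat n n" using B unfolding T_def by auto
  have conj: "P * X * Q \<in> carrier_mat n n" if "X \<in> carrier_mat n n" for X using P Q that by auto
  have conj_minus: "P * (X - Y) * Q = P * X * Q - P * Y * Q"
    if "X \<in> carrier_mat n n" "Y \<in> carrier_mat n n" for X Y
    using P Q that by (simp add: mult_minus_distrib_mat[OF P] minus_mult_distrib_mat[of "P * X" n n])
  have conj_smult: "P * (c \<cdot>\<^sub>m X) * Q = c \<cdot>\<^sub>m (P * X * Q)" if "X \<in> carrier_mat n n" for c X
    using P Q that by (simp add: mult_smult_distrib[OF P] mult_smult_assoc_mat[of "P * X" n n])
  have conj_mult: "P * (X * Y) * Q = (P * X * Q) * (P * Y * Q)"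
    if X: "X \<in> carrier_mat n n" and Y: "Y \<in> carrier_mat n n" for X Y
  proof -
    have "(P * X * Q) * (P * Y * Q) = P * (X * ((Q * P) * (Y * Q)))"
      using P Q X Y by (simp add: assoc_mult_mat[of _ n n _ n _ n])
    also have "\<dots> = P * (X * Y) * Q"
      unfolding QP using P Q X Y by (simp add: assoc_mult_mat[of _ n n _ n _ n])
    finally show ?thesis by simp
  qed
  have PT: "P * T * Q = A"
    unfolding T_def A using B P Q PQ
    by (simp add: conj_minus conj_smult LB)
  have utT: "upper_triangular T"
    using ut B unfolding T_def by (auto simp: upper_triangular_def)
  have diT: "T $$ (i, i) = d - es ! i" if "i < n" for i
    using B that unfolding T_def by (simp add: esi)
  have "\<exists>U \<in> carrier_mat n n. upper_triangular U \<and> N k = P * U * Q \<and>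
      (\<forall>i<n. U $$ (i, i) = poly (nb_poly d k) (d - es ! i))" for k
  proof (induction k rule: induct_nat_012)
    case 0
    show ?case using P Q PQ by (intro bexI[of _ "1\<^sub>m n"]) (simp_all add: N0)
  next
    case 1
    show ?case using T utT PT diT by (intro bexI[of _ T]) (simp_all add: N1)
  next
    case (ge2 k)
    let ?c = "if k = 0 then d else d - 1"
    obtain U where U: "U \<in> carrier_mat n n" "upper_triangular U" "N k = P * U * Q"
      "\<And>i. i < n \<Longrightarrow> U $$ (i, i) = poly (nb_poly d k) (d - es ! i)" using ge2(1) by blast
    obtain V where V: "V \<in> carrier_mat n n" "upper_triangular V" "N (Suc k) = P * V * Q"
      "\<And>i. i < n \<Longrightarrow> V $$ (i, i) = poly (nb_poly d (Suc k)) (d - es ! i)" using ge2(2) by blast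
    let ?W = "T * V - ?c \<cdot>\<^sub>m U"
    have TV: "T * V \<in> carrier_mat n n" using T V by auto
    show ?case
    proof (intro bexI[of _ ?W] conjI allI impI)
      show "?W \<in> carrier_mat n n" using U TV by auto
      show "upper_triangular ?W"
        using upper_triangularD[OF upper_triangular_mult(1)[OF T utT V(1,2)]]
          upper_triangularD[OF U(2)] U(1) T V(1)
        by (intro upper_triangularI) simp
      have "P * ?W * Q = P * (T * V) * Q - ?c \<cdot>\<^sub>m (P * U * Q)"
        using TV U(1) by (subst conj_minus) (simp_all add: conj_smult)
      then show "N (Suc (Suc k)) = P * ?W * Q"
        using conj_mult[OF T V(1)] by (simp add: N PT U(3) V(3))
      show "?W $$ (i, i) = poly (nb_poly d (Suc (Suc k))) (d - es ! i)" if "i < n" for i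
        using that T U V TV upper_triangular_mult(2)[OF T utT V(1,2) that] by (simp add: diT)
    qed
  qed
  then obtain U where U: "U \<in> carrier_mat n n" "N k = P * U * Q"
    "\<And>i. i < n \<Longrightarrow> U $$ (i, i) = poly (nb_poly d k) (d - es ! i)" by blast
  have "mat_trace (N k) = mat_trace (Q * (P * U))"
    unfolding U(2) using P Q U(1) by (intro mat_trace_commute) auto
  also have "Q * (P * U) = U"
    using assoc_mult_mat[OF Q P U(1)] QP U(1) by simp
  also have "mat_trace U = (\<Sum>i<n. poly (nb_poly d k) (d - es ! i))"
    using U by (simp add: mat_trace_def)
  also have "\<dots> = spectral_sum (map (\<lambda>e. d - e) es) (nb_poly d k)"
    unfolding spectral_sum_def sum_list_sum_nth using len
    by (simp add: atLeast0LessThan)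
  finally show ?thesis .
qed

section \<open>Non-backtracking walks and girth\<close>

text \<open>
  The number of non-backtracking walks \<open>a, b, \<dots>, v\<close> with \<open>k\<close> steps after the initial step from \<open>a\<close>
  to \<open>b\<close>. The predecessor \<open>a\<close> is recorded to forbid the step back.
\<close>

fun nb_walks :: "('a \<Rightarrow> 'a set) \<Rightarrow> nat \<Rightarrow> 'a \<Rightarrow> 'a \<Rightarrow> 'a \<Rightarrow> real" where
  "nb_walks N 0 a b v = of_bool (b = v)"
| "nb_walks N (Suc k) a b v = (\<Sum>x\<in>N b - {a}. nb_walks N k b x v)"

fun nb_count :: "('a \<Rightarrow> 'a set) \<Rightarrow> nat \<Rightarrow> 'a \<Rightarrow> 'a \<Rightarrow> real" where
  "nb_count N 0 u v = of_bool (u = v)"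
| "nb_count N (Suc k) u v = (\<Sum>w\<in>N u. nb_walks N k u w v)"

lemma nb_count_minus:
  assumes "finite (N u)" "w \<in> N u"
  shows "nb_walks N (Suc k) w u v = nb_count N (Suc k) u v - nb_walks N k u w v"
  using assms by (simp add: sum_diff1)

text \<open>
  Put a step from \<open>u\<close> to \<open>w\<close> in front of a walk from \<open>w\<close>. If the result backtracks, it is \<open>u, w, u, \<dots>\<close>,
  and dropping two steps leaves a walk from \<open>u\<close> whose first step does not go to \<open>w\<close>.
\<close>

lemma nb_count_rec:
  assumes fin: "\<And>x. finite (N x)" and sym: "\<And>x y. y \<in> N x \<Longrightarrow> x \<in> N y"
    and card: "card (N u) = d"
  shows "(\<Sum>w\<in>N u. nb_count N (Suc k) w v) =
    nb_count N (Suc (Suc k)) u v + (if k = 0 then real d else real d - 1) * nb_count N k u v"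
proof -
  have "(\<Sum>w\<in>N u. nb_count N (Suc k) w v) =
      (\<Sum>w\<in>N u. nb_walks N (Suc k) u w v + nb_walks N k w u v)"
    by (intro sum.cong refl) (subst nb_count_minus, use fin sym in auto)
  also have "\<dots> = nb_count N (Suc (Suc k)) u v + (\<Sum>w\<in>N u. nb_walks N k w u v)"
    by (simp only: sum.distrib nb_count.simps)
  also have "(\<Sum>w\<in>N u. nb_walks N k w u v) = (if k = 0 then real d else real d - 1) * nb_count N k u v"
  proof (cases k)
    case 0
    then show ?thesis using card by simp
  next
    case (Suc l)
    have "(\<Sum>w\<in>N u. nb_walks N k w u v) = (\<Sum>w\<in>N u. nb_count N (Suc l) u v - nb_walks N l u w v)"
      unfolding Suc by (intro sum.cong refl nb_count_minus fin)
    also have "\<dots> = real d * nb_count N (Suc l) u v - nb_count N (Suc l) u v"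
      unfolding sum_subtractf by (simp add: card)
    finally show ?thesis using Suc by (simp add: algebra_simps)
  qed
  finally show ?thesis .
qed

definition nb_walk :: "('a \<Rightarrow> 'a set) \<Rightarrow> nat \<Rightarrow> (nat \<Rightarrow> 'a) \<Rightarrow> bool" where
  "nb_walk N k f \<longleftrightarrow> (\<forall>i<k. f (Suc i) \<in> N (f i)) \<and> (\<forall>i. Suc i < k \<longrightarrow> f (Suc (Suc i)) \<noteq> f i)"

lemma nb_walks_nonzero:
  assumes "nb_walks N k a b v \<noteq> 0" "b \<in> N a"
  shows "\<exists>f. nb_walk N (Suc k) f \<and> f 0 = a \<and> f (Suc 0) = b \<and> f (Suc k) = v"
  using assms
proof (induction k arbitrary: a b)
  case 0
  then show ?case
    by (intro exI[of _ "\<lambda>i. if i = 0 then a else b"]) (auto simp: nb_walk_def split: if_splits)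
next
  case (Suc k)
  from Suc.prems(1) obtain x where x: "x \<in> N b" "x \<noteq> a" "nb_walks N k b x v \<noteq> 0"
    by (auto elim: sum.not_neutral_contains_not_neutral)
  from Suc.IH[OF x(3,1)] obtain f where
    f: "nb_walk N (Suc k) f" "f 0 = b" "f (Suc 0) = x" "f (Suc k) = v" by blast
  let ?f = "case_nat a f"
  have "nb_walk N (Suc (Suc k)) ?f"
    using f x Suc.prems(2) by (auto simp: nb_walk_def split: nat.split)
  then show ?case using f by (intro exI[of _ ?f]) simp
qed

text \<open>
  A shortest stretch of the walk between two visits to the same vertex has no other repetition. It
  has at least three steps, as there are no loops and the walk does not backtrack.
\<close>

lemma closed_nb_walk_imp_cycle:
  fixes G :: "('a, 'b) pre_digraph"
  assumes G: "loopfree_digraph G"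
    and f: "nb_walk (\<lambda>v. {w. (v, w) \<in> arcs_ends G}) k f" "f 0 = f k" and k: "k > 0"
  shows "\<exists>p. pre_digraph.cycle G p \<and> 3 \<le> length p \<and> length p \<le> k"
proof -
  interpret loopfree_digraph G by fact
  let ?rep = "\<lambda>m. 0 < m \<and> (\<exists>i. i + m \<le> k \<and> f i = f (i + m))"
  define m where "m = (LEAST m. ?rep m)"
  have "?rep k" using f(2) k by auto
  then have "?rep m" unfolding m_def by (rule LeastI)
  then obtain i where i: "0 < m" "i + m \<le> k" "f i = f (i + m)" by blast
  have least: "\<not> ?rep l" if "l < m" for l using not_less_Least[of l ?rep] that unfolding m_def by blast
  have adj: "(f j, f (Suc j)) \<in> arcs_ends G" if "j < k" for j
    using f(1) that by (auto simp: nb_walk_def)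
  have "\<forall>j. \<exists>e. j < k \<longrightarrow> e \<in> arcs G \<and> tail G e = f j \<and> head G e = f (Suc j)"
    using adj unfolding arcs_ends_conv by fastforce
  then obtain e where e: "\<And>j. j < k \<Longrightarrow> e j \<in> arcs G \<and> tail G (e j) = f j \<and> head G (e j) = f (Suc j)"
    by metis
  have walk: "j + l \<le> k \<Longrightarrow> cas (f j) (map e [j..<j + l]) (f (j + l)) \<and>
      awalk_verts (f j) (map e [j..<j + l]) = map f [j..<Suc (j + l)]" for j l
  proof (induction l arbitrary: j)
    case (Suc l)
    have "[j..<j + Suc l] = j # [Suc j..<Suc j + l]" "[j..<Suc (j + Suc l)] = j # [Suc j..<Suc (Suc j + l)]"
      by (simp_all add: upt_conv_Cons del: upt_Suc)
    then show ?case using Suc.IH[of "Suc j"] Suc.prems e[of j] by (simp del: upt_Suc)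
  qed simp
  let ?p = "map e [i..<i + m]"
  have inj: "inj_on f {Suc i..i + m}"
  proof (rule linorder_inj_onI')
    fix a b assume ab: "a \<in> {Suc i..i + m}" "b \<in> {Suc i..i + m}" "a < b"
    then have "b - a < m" "a + (b - a) \<le> k" "0 < b - a" using i(2) by auto
    moreover have "a + (b - a) = b" using ab(3) by simp
    ultimately show "f a \<noteq> f b" using least[of "b - a"] by metis
  qed
  have "cycle ?p"
    unfolding cycle_def awalk_def
  proof (intro exI[of _ "f i"] conjI)
    show "f i \<in> verts G" using e[of i] i tail_in_verts[of "e i"] by auto
    show "set ?p \<subseteq> arcs G" using e i by auto
    show "cas (f i) ?p (f i)" using walk[OF i(2)] i(3) by simp
    have "tl (awalk_verts (f i) ?p) = map f [Suc i..<Suc (i + m)]"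
      using walk[OF i(2)] i(1) by (simp del: upt_Suc add: map_tl [symmetric])
    then show "distinct (tl (awalk_verts (f i) ?p))"
      using inj by (simp del: upt_Suc add: distinct_map atLeastLessThanSuc_atLeastAtMost)
    show "?p \<noteq> []" using i(1) by simp
  qed
  moreover have "m \<noteq> 1"
    using e[of i] i no_loops[of "e i"] by auto
  moreover have "m \<noteq> 2"
  proof
    assume "m = 2"
    then have "f (Suc (Suc i)) \<noteq> f i" using f(1) i(2) by (simp add: nb_walk_def)
    then show False using i(3) \<open>m = 2\<close> by simp
  qed
  ultimately show ?thesis using i(1,2) by (intro exI[of _ ?p]) auto
qed

lemma nb_count_closed_zero:
  fixes G :: "('a, 'b) pre_digraph"
  assumes G: "loopfree_digraph G" and g: "girth G = enat g" and k: "1 \<le> k" "k < g"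
  shows "nb_count (\<lambda>v. {w. (v, w) \<in> arcs_ends G}) k v v = 0"
proof (rule ccontr)
  let ?N = "\<lambda>v. {w. (v, w) \<in> arcs_ends G}"
  assume nz: "nb_count ?N k v v \<noteq> 0"
  obtain l where l: "k = Suc l" using k(1) by (cases k) auto
  obtain w where "w \<in> ?N v" "nb_walks ?N l v w v \<noteq> 0"
    using nz unfolding l nb_count.simps by (elim sum.not_neutral_contains_not_neutral)
  from nb_walks_nonzero[OF this(2,1)] obtain f where "nb_walk ?N k f" "f 0 = f k" unfolding l by auto
  with closed_nb_walk_imp_cycle[OF G this] k obtain p where
    p: "pre_digraph.cycle G p" "3 \<le> length p" "length p \<le> k" by auto
  then have "girth G \<le> enat (length p)" unfolding girth_def by (intro INF_lower) simp
  then show False using p(3) k(2) unfolding g by simp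
qed

lemma girth_ge_3: "girth G = enat g \<Longrightarrow> g \<ge> 3"
proof -
  assume g: "girth G = enat g"
  have "enat 3 \<le> girth G" unfolding girth_def by (intro INF_greatest) simp
  then show ?thesis unfolding g by simp
qed

lemma (in graph) card_neighbours:
  "card {w. (v, w) \<in> arcs_ends G} = out_degree G v"
proof -
  have "{w. (v, w) \<in> arcs_ends G} = head G ` out_arcs G v"
    by (auto simp: arcs_ends_conv)
  moreover have "inj_on (head G) (out_arcs G v)"
    by (rule inj_onI) (auto intro: no_multi_arcs simp: arc_to_ends_def)
  ultimately show ?thesis by (simp add: card_image out_degree_def)
qed

section \<open>The Laplacian of a regular graph\<close>

context graph
begin

definition adj_mat :: "'a list \<Rightarrow> real mat" where
  "adj_mat vs = Matrix.mat (length vs) (length vs)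
     (\<lambda>(i, j). of_bool ((vs ! i, vs ! j) \<in> arcs_ends G))"

lemma sum_neighbours:
  assumes vs: "distinct vs" "set vs = verts G"
  shows "(\<Sum>j<length vs. of_bool ((v, vs ! j) \<in> arcs_ends G) * h (vs ! j)) =
    (\<Sum>w\<in>{w. (v, w) \<in> arcs_ends G}. h w :: real)"
proof -
  have sub: "{w. (v, w) \<in> arcs_ends G} \<subseteq> verts G"
    by (auto simp: arcs_ends_conv)
  have "(\<Sum>j<length vs. of_bool ((v, vs ! j) \<in> arcs_ends G) * h (vs ! j)) =
      (\<Sum>w\<in>verts G. of_bool ((v, w) \<in> arcs_ends G) * h w)"
    using bij_betw_nth[OF vs(1) refl refl] vs(2)
    by (intro sum.reindex_bij_betw) simp
  also have "\<dots> = (\<Sum>w\<in>{w. (v, w) \<in> arcs_ends G}. of_bool ((v, w) \<in> arcs_ends G) * h w)"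
    using sub by (intro sum.mono_neutral_right) auto
  finally show ?thesis by simp
qed

lemma laplacian_eq_adj:
  assumes "regular_graph G d" "set vs = verts G" "distinct vs"
  shows "laplacian_matrix G vs = real d \<cdot>\<^sub>m 1\<^sub>m (length vs) - adj_mat vs"
  using assms
  by (intro eq_matI) (auto simp: laplacian_matrix_def adj_mat_def regular_graph_def)

lemma laplacian_eigenvector_entry:
  assumes reg: "regular_graph G d" and vs: "distinct vs" "set vs = verts G"
    and ev: "eigenvector (laplacian_matrix G vs) x e" and i: "i < length vs"
  shows "(\<Sum>j<length vs. of_bool ((vs ! i, vs ! j) \<in> arcs_ends G) * x $ j) = (real d - e) * x $ i"
proof -
  let ?n = "length vs"
  have L: "laplacian_matrix G vs \<in> carrier_mat ?n ?n" by (simp add: laplacian_matrix_def)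
  have "e * x $ i = (\<Sum>j<?n. laplacian_matrix G vs $$ (i, j) * x $ j)"
    using eigenvector_entry[OF L ev i] by simp
  also have "\<dots> = (\<Sum>j<?n. (if j = i then real d * x $ i else 0) -
      of_bool ((vs ! i, vs ! j) \<in> arcs_ends G) * x $ j)"
    using reg i vs(2) nth_mem[OF i]
    by (intro sum.cong refl) (auto simp: laplacian_matrix_def regular_graph_def algebra_simps)
  also have "\<dots> = real d * x $ i - (\<Sum>j<?n. of_bool ((vs ! i, vs ! j) \<in> arcs_ends G) * x $ j)"
    using i by (simp add: sum_subtractf)
  finally show ?thesis by (simp add: algebra_simps)
qed

lemma sum_neighbours_regular:
  assumes reg: "regular_graph G d" and vs: "distinct vs" "set vs = verts G" and i: "i < length vs"
  shows "(\<Sum>j<length vs. of_bool ((vs ! i, vs ! j) \<in> arcs_ends G)) = real d"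
proof -
  have "card {w. (vs ! i, w) \<in> arcs_ends G} = d"
    using card_neighbours reg vs(2) nth_mem[OF i] by (simp add: regular_graph_def)
  then show ?thesis using sum_neighbours[OF vs, of "vs ! i" "\<lambda>_. 1"] by simp
qed

text \<open>
  Compare the entries of the eigenvector at a position where its absolute value is maximal.
\<close>

lemma laplacian_eigenvalue_le:
  assumes reg: "regular_graph G d" and vs: "distinct vs" "set vs = verts G"
    and ev: "eigenvalue (laplacian_matrix G vs) e"
  shows "e \<le> 2 * real d"
proof -
  let ?n = "length vs" and ?a = "\<lambda>i j. of_bool ((vs ! i, vs ! j) \<in> arcs_ends G) :: real"
  obtain x where x: "eigenvector (laplacian_matrix G vs) x e" using ev unfolding eigenvalue_def by blast
  then have xn: "x \<in> carrier_vec ?n" "x \<noteq> 0\<^sub>v ?n"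
    by (auto simp: eigenvector_def laplacian_matrix_def)
  then obtain l where l: "l < ?n" "x $ l \<noteq> 0"
    by (metis carrier_vecD eq_vecI index_zero_vec(1,2))
  define m where "m = Max ((\<lambda>i. \<bar>x $ i\<bar>) ` {..<?n})"
  have "m \<in> (\<lambda>i. \<bar>x $ i\<bar>) ` {..<?n}" unfolding m_def using l by (intro Max_in) auto
  then obtain i where i: "i < ?n" "m = \<bar>x $ i\<bar>" by auto
  have le: "\<bar>x $ j\<bar> \<le> m" if "j < ?n" for j unfolding m_def using that by (intro Max_ge) auto
  have m: "m > 0" using le[OF l(1)] l(2) by linarith
  have "\<bar>real d - e\<bar> * m = \<bar>\<Sum>j<?n. ?a i j * x $ j\<bar>"
    unfolding laplacian_eigenvector_entry[OF reg vs x i(1)] by (simp add: abs_mult i(2))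
  also have "\<dots> \<le> (\<Sum>j<?n. \<bar>?a i j * x $ j\<bar>)" by (rule sum_abs)
  also have "\<dots> \<le> (\<Sum>j<?n. ?a i j * m)"
    by (intro sum_mono) (simp add: abs_mult le mult_left_mono)
  also have "\<dots> = real d * m"
    unfolding sum_distrib_right [symmetric] sum_neighbours_regular[OF reg vs i(1)] ..
  finally have "\<bar>real d - e\<bar> \<le> real d" using m by simp
  then show ?thesis by linarith
qed

lemma laplacian_eigenvalue_0:
  assumes reg: "regular_graph G d" and vs: "distinct vs" "set vs = verts G" and "verts G \<noteq> {}"
  shows "eigenvalue (laplacian_matrix G vs) 0"
proof -
  let ?n = "length vs" and ?L = "laplacian_matrix G vs" and ?x = "vec (length vs) (\<lambda>_. 1 :: real)"
  have n: "0 < ?n" using assms(4) vs(2) by auto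
  have "eigenvector ?L ?x 0"
    unfolding eigenvector_def
  proof (intro conjI)
    show "?x \<noteq> 0\<^sub>v (dim_row ?L)"
      using n by (auto simp: laplacian_matrix_def dest!: arg_cong[where f = "\<lambda>v. v $ 0"])
    show "?L *\<^sub>v ?x = 0 \<cdot>\<^sub>v ?x"
    proof (rule eq_vecI)
      fix i assume "i < dim_vec (0 \<cdot>\<^sub>v ?x)"
      then have i: "i < ?n" by simp
      have "(?L *\<^sub>v ?x) $ i = (\<Sum>j<?n. ?L $$ (i, j))"
        using i by (simp add: scalar_prod_def atLeast0LessThan laplacian_matrix_def)
      also have "\<dots> = (\<Sum>j<?n. (if j = i then real d else 0) - of_bool ((vs ! i, vs ! j) \<in> arcs_ends G))"
        using reg i vs(2) nth_mem[OF i]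
        by (intro sum.cong refl) (auto simp: laplacian_matrix_def regular_graph_def)
      also have "\<dots> = 0"
        unfolding sum_subtractf sum_neighbours_regular[OF reg vs i] using i by simp
      finally show "(?L *\<^sub>v ?x) $ i = (0 \<cdot>\<^sub>v ?x) $ i" using i by simp
    qed (simp add: laplacian_matrix_def)
  qed (simp add: laplacian_matrix_def)
  then show ?thesis unfolding eigenvalue_def by blast
qed

lemma spectral_sum_nb_poly_laplacian:
  assumes reg: "regular_graph G d" and vs: "distinct vs" "set vs = verts G"
    and cp: "char_poly (laplacian_matrix G vs) = (\<Prod>e\<leftarrow>es. [:- e, 1:])"
  shows "spectral_sum (map (\<lambda>e. real d - e) es) (nb_poly (real d) k) =
    (\<Sum>v\<in>verts G. nb_count (\<lambda>v. {w. (v, w) \<in> arcs_ends G}) k v v)"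
proof -
  let ?n = "length vs" and ?N = "\<lambda>v. {w. (v, w) \<in> arcs_ends G}"
  define M where "M k = Matrix.mat ?n ?n (\<lambda>(i, j). nb_count ?N k (vs ! i) (vs ! j))" for k
  have adj: "adj_mat vs \<in> carrier_mat ?n ?n" by (simp add: adj_mat_def)
  have fin: "finite (?N x)" for x
    by (rule finite_subset[of _ "verts G"]) (auto simp: arcs_ends_conv)
  have sym: "x \<in> ?N y" if "y \<in> ?N x" for x y
    using that arcs_ends_symmetric[OF sym_arcs] by simp
  have adj_M: "(adj_mat vs * M k) $$ (i, j) = (\<Sum>w\<in>?N (vs ! i). nb_count ?N k w (vs ! j))"
    if "i < ?n" "j < ?n" for i j k
    using that sum_neighbours[OF vs, of "vs ! i" "\<lambda>w. nb_count ?N k w (vs ! j)"]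
    by (subst mat_mult_entry[OF adj, of "M k"]) (auto simp: M_def adj_mat_def)
  have "mat_trace (M k) = spectral_sum (map (\<lambda>e. real d - e) es) (nb_poly (real d) k)"
  proof (rule trace_nb_poly[where A = "adj_mat vs", OF _ cp])
    show "laplacian_matrix G vs \<in> carrier_mat ?n ?n" by (simp add: laplacian_matrix_def)
    show "adj_mat vs = real d \<cdot>\<^sub>m 1\<^sub>m ?n - laplacian_matrix G vs"
      unfolding laplacian_eq_adj[OF reg vs(2,1)] by (intro eq_matI) (auto simp: adj_mat_def)
    show "M 0 = 1\<^sub>m ?n"
      using vs(1) by (intro eq_matI) (auto simp: M_def nth_eq_iff_index_eq)
    show "M (Suc 0) = adj_mat vs"
      using fin by (intro eq_matI) (auto simp: M_def adj_mat_def of_bool_def)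
    show "M (Suc (Suc k)) = adj_mat vs * M (Suc k) - (if k = 0 then real d else real d - 1) \<cdot>\<^sub>m M k" for k
    proof (rule eq_matI)
      let ?c = "if k = 0 then real d else real d - 1"
      fix i j assume "i < dim_row (adj_mat vs * M (Suc k) - ?c \<cdot>\<^sub>m M k)"
        "j < dim_col (adj_mat vs * M (Suc k) - ?c \<cdot>\<^sub>m M k)"
      then have ij: "i < ?n" "j < ?n" by (simp_all add: M_def)
      have card: "card (?N (vs ! i)) = d"
        using card_neighbours reg vs(2) nth_mem[OF ij(1)] by (simp add: regular_graph_def)
      have "(adj_mat vs * M (Suc k)) $$ (i, j) =
          nb_count ?N (Suc (Suc k)) (vs ! i) (vs ! j) + ?c * nb_count ?N k (vs ! i) (vs ! j)"
        unfolding adj_M[OF ij] by (rule nb_count_rec[of ?N, OF fin sym card])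
      then show "M (Suc (Suc k)) $$ (i, j) = (adj_mat vs * M (Suc k) - ?c \<cdot>\<^sub>m M k) $$ (i, j)"
        using ij by (simp add: M_def adj_mat_def del: nb_count.simps)
    qed (simp_all add: M_def adj_mat_def)
  qed
  moreover have "mat_trace (M k) = (\<Sum>i<?n. nb_count ?N k (vs ! i) (vs ! i))"
    by (simp add: mat_trace_def M_def)
  moreover have "\<dots> = (\<Sum>v\<in>verts G. nb_count ?N k v v)"
    using bij_betw_nth[OF vs(1) refl refl] vs(2)
    by (intro sum.reindex_bij_betw) simp
  ultimately show ?thesis by simp
qed

end

section \<open>Girth-maximal graphs are Moore graphs\<close>

text \<open>
  As the second smallest entry is positive, the entry \<open>0\<close> is the smallest one.
\<close>

lemma sorted_second_pos:
  fixes es :: "real list"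
  assumes "length es \<ge> 2" "0 \<in> set es" "sort es ! 1 = \<mu>" "\<mu> > 0"
  shows "\<exists>rs. mset es = mset (0 # rs) \<and> (\<forall>r\<in>set rs. \<mu> \<le> r)"
proof -
  obtain a b rs where s: "sort es = a # b # rs"
    using assms(1) by (metis Suc_le_length_iff length_sort numeral_2_eq_2)
  have "sorted (a # b # rs)" unfolding s[symmetric] by simp
  then have srt: "\<forall>r\<in>set (b # rs). b \<le> r" "a \<le> b" by auto
  have b: "b = \<mu>" using assms(3) by (simp add: s)
  have "0 \<in> set (a # b # rs)" using assms(2) unfolding s[symmetric] by simp
  then have "a = 0" using srt assms(4) b by auto
  then have "mset es = mset (0 # b # rs)" by (metis s mset_sort)
  then show ?thesis using srt(1) b by blast
qed

text \<open>
  The adjacency eigenvalues are \<open>d - e\<close> for the Laplacian eigenvalues \<open>e\<close>. The bound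
  \<open>\<tau> < d\<close> makes the algebraic connectivity positive, which leaves a single eigenvalue \<open>0\<close> of the
  Laplacian and puts the other eigenvalues of the adjacency matrix into \<open>[- d, \<tau>]\<close>.
\<close>

theorem theoremI4:
  fixes G :: "('a, 'b) pre_digraph" and d g :: nat
  assumes "Digraph.graph G" and "Digraph_Component.connected G"
    and "d \<ge> 2"
    and "regular_graph G d" and "girth G = enat g"
    and "girth_maximal G d g"
  shows "moore_graph G d g"
proof -
  interpret graph G by fact
  note reg = \<open>regular_graph G d\<close>
  define vs where "vs = vertex_list G"
  have vs: "distinct vs" "set vs = verts G" using vertex_list[of G] by (simp_all add: vs_def)
  let ?L = "laplacian_matrix G vs" and ?n = "length vs"
  have L: "?L \<in> carrier_mat ?n ?n" by (simp add: laplacian_matrix_def)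
  have ne: "verts G \<noteq> {}"
    using assms(2) by (auto simp: connected_def strongly_connected_def)
  obtain v where v: "v \<in> verts G" using ne by blast
  have card: "card (verts G) = ?n" using distinct_card[OF vs(1)] vs(2) by simp
  have n2: "?n \<ge> 2"
  proof -
    have "card {w. (v, w) \<in> arcs_ends G} = d"
      using card_neighbours reg v by (simp add: regular_graph_def)
    moreover have "card {w. (v, w) \<in> arcs_ends G} \<le> card (verts G)"
      by (intro card_mono) (auto simp: arcs_ends_conv)
    ultimately show ?thesis using card assms(3) by simp
  qed
  have "(vs ! i, vs ! j) \<in> arcs_ends G \<longleftrightarrow> (vs ! j, vs ! i) \<in> arcs_ends G" for i j
    using arcs_ends_symmetric[OF sym_arcs] by blast
  then have "?L $$ (i, j) = ?L $$ (j, i)" if "i < ?n" "j < ?n" for i j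
    using that by (simp add: laplacian_matrix_def)
  then obtain es where cp: "char_poly ?L = (\<Prod>e\<leftarrow>es. [:- e, 1:])" and len: "length es = ?n"
    using symmetric_char_poly_splits[OF L] by blast
  have root: "e \<in> set es \<longleftrightarrow> eigenvalue ?L e" for e
    unfolding eigenvalue_root_char_poly[OF L] cp
    by (auto simp: poly_prod_list prod_list_zero_iff)
  have "laplacian_spectrum G = mset es"
  proof -
    have "proots (\<Prod>e\<leftarrow>es. [:- e, 1:]) = mset es"
    proof (induction es)
      case (Cons e es)
      have "(\<Prod>e\<leftarrow>es. [:- e, 1:]) \<noteq> 0" by (auto simp: prod_list_zero_iff)
      then show ?case using Cons by (simp add: proots_mult del: mult_pCons_left)
    qed simp
    then show ?thesis unfolding laplacian_spectrum_def vs_def[symmetric] cp .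
  qed
  then have ac: "algebraic_connectivity G = sort es ! 1"
    by (simp add: algebraic_connectivity_def)
  obtain \<theta> where \<theta>: "girth_angle d g \<theta>" "sort es ! 1 = real d - 2 * sqrt (real d - 1) * cos \<theta>"
    using assms(6) unfolding girth_maximal_def ac by blast
  have g: "g \<ge> 3" by (rule girth_ge_3[OF assms(5)])
  have "sin \<theta> > 0" by (rule girth_angle_sin_pos[OF \<theta>(1) assms(3) g])
  then have "2 * sqrt (real d - 1) * cos \<theta> < real d"
    using assms(3) by (intro moore_value_less_degree) simp_all
  then have "\<exists>rs. mset es = mset (0 # rs) \<and> (\<forall>r\<in>set rs. real d - 2 * sqrt (real d - 1) * cos \<theta> \<le> r)"
    using root laplacian_eigenvalue_0[OF reg vs ne] len n2 \<theta>(2)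
    by (intro sorted_second_pos) auto
  then obtain rs where rs: "mset es = mset (0 # rs)"
    "\<And>r. r \<in> set rs \<Longrightarrow> real d - 2 * sqrt (real d - 1) * cos \<theta> \<le> r" by blast
  let ?xs = "map (\<lambda>e. real d - e) rs"
  have sub: "set rs \<subseteq> set es" using mset_eq_setD[OF rs(1)] by auto
  have "length (real d # ?xs) = moore_bound d g"
  proof (rule count_eq_moore_bound[OF _ assms(3) g \<theta>(1)])
    fix k assume k: "1 \<le> k" "k < g"
    have "spectral_sum (real d # ?xs) f = spectral_sum (map (\<lambda>e. real d - e) es) f" for f
    proof -
      have "mset (map (poly f) (map (\<lambda>e. real d - e) es)) = mset (map (poly f) (real d # ?xs))"
        using arg_cong[OF rs(1), of "image_mset (\<lambda>e. poly f (real d - e))"] by (simp add: comp_def)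
      then show ?thesis unfolding spectral_sum_def by (metis sum_mset_sum_list)
    qed
    then show "spectral_sum (real d # ?xs) (nb_poly (real d) k) = 0"
      using spectral_sum_nb_poly_laplacian[OF reg vs cp, of k]
        nb_count_closed_zero[OF loopfree_digraph_axioms assms(5) k] by simp
  next
    fix x assume "x \<in> set ?xs"
    then obtain r where r: "r \<in> set rs" "x = real d - r" by auto
    have "r \<le> 2 * real d"
      using laplacian_eigenvalue_le[OF reg vs] root r(1) sub by blast
    then show "- real d \<le> x \<and> x \<le> 2 * sqrt (real d - 1) * cos \<theta>" using rs(2)[OF r(1)] r(2) by simp
  qed
  moreover have "length (real d # ?xs) = card (verts G)"
    using mset_eq_length[OF rs(1)] len card by simp
  ultimately show ?thesis unfolding moore_graph_def using assms(4,5) by simp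
qed

end
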